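(* Let $S\subset B(H)$ be a closed subspace ($H$ a Hilbert space), and consider $M_n(S)=M_n\otimes S\subset B(\ell_2^n(H))$. Then: (i) $\lambda_n(S)=\lambda(M_n(S))$ for every $n\ge1$. (ii) If $S$ is $\sigma(B(H),B(H)_* )$-closed in $B(H)$ then $$\lambda_{cb}(S)=\sup_{n\ge1}\lambda_n(S).$$ For any infinite dimensional Hilbert space $K$ we then have $$\lambda_{cb}(S)\le\lambda(B(K)\otimes S).$$ Moreover, let $B(K)\overline\otimes S$ denote the weak-$*$ closure of $B(K)\otimes S$ in $B(K\otimes H)$. Then $$\lambda_{cb}(S)=\lambda(B(K)\overline\otimes S).$$
   Context: For a closed subspace $S\subset B(H)$, $\lambda(S)$ (resp. $\lambda_{cb}(S)$, resp. $\lambda_n(S)$) is the infimum of the constants $\lambda$ such that there is a linear projection $P$ from $B(H)$ onto $S$ satisfying $\|P\|\le\lambda$ (resp. $\|P\|_{cb}\le\lambda$, resp. $\|I_{M_n}\otimes P\|_{M_n(B(H))\to M_n(S)}\le\lambda$); the infimum is $+\infty$ if there is no such projection. $M_n(S)$ is regarded as a subspace of $M_n(B(H))=B(\ell_2^n(H))$; $B(K)\otimes S$ denotes the norm closure of the algebraic tensor product in $B(K\otimes H)$, where $K\otimes H$ is the Hilbert space tensor product, and $B(K)\otimes S$ and $B(K)\overline\otimes S$ are regarded as subspaces of $B(K\otimes H)$ for the definition of $\lambda$. *)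

theory Defs
  imports "HOL-Analysis.Analysis"
begin

section \<open>Complex Hilbert spaces\<close>

class scaleC =
  fixes scaleC :: "complex \<Rightarrow> 'a \<Rightarrow> 'a" (infixr \<open>*\<^sub>C\<close> 75)

class complex_vector = scaleC + real_vector +
  assumes scaleC_add_right: "c *\<^sub>C (x + y) = c *\<^sub>C x + c *\<^sub>C y"
    and scaleC_add_left: "(c + d) *\<^sub>C x = c *\<^sub>C x + d *\<^sub>C x"
    and scaleC_scaleC: "c *\<^sub>C d *\<^sub>C x = (c * d) *\<^sub>C x"
    and scaleC_of_real: "complex_of_real r *\<^sub>C x = r *\<^sub>R x"

global_interpretation complex_vector: vector_space "scaleC :: complex \<Rightarrow> 'a \<Rightarrow> 'a::complex_vector"
  defines cspan = complex_vector.span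
    and csubspace = complex_vector.subspace
proof
  fix x :: 'a
  show "1 *\<^sub>C x = x"
    using scaleC_of_real[of 1 x] by simp
qed (simp_all add: scaleC_add_right scaleC_add_left scaleC_scaleC)

text \<open>The complex inner product is linear in its first argument. Norm, metric and topology are
  those of the underlying real inner product space, whose inner product is the real part of the
  complex one.\<close>

class complex_hilbert = complex_vector + real_inner + complete_space +
  fixes cinner :: "'a \<Rightarrow> 'a \<Rightarrow> complex"
  assumes cinner_commute: "cinner x y = cnj (cinner y x)"
    and cinner_add_left: "cinner (x + y) z = cinner x z + cinner y z"
    and cinner_scaleC_left: "cinner (c *\<^sub>C x) y = c * cinner x y"
    and Re_cinner: "Re (cinner x y) = inner x y"

lemma cinner_self: "cinner x x = complex_of_real ((norm x)\<^sup>2)"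
proof (rule complex_eqI)
  show "Im (cinner x x) = Im (complex_of_real ((norm x)\<^sup>2))"
    using arg_cong[OF cinner_commute[of x x], of Im] by simp
qed (simp add: Re_cinner power2_norm_eq_inner)

lemma cinner_scaleC_right: "cinner x (c *\<^sub>C y) = cnj c * cinner x y"
  by (metis cinner_commute cinner_scaleC_left complex_cnj_mult)

lemma norm_scaleC: "norm (c *\<^sub>C x) = cmod c * norm x" for x :: "'a::complex_hilbert"
proof -
  have "complex_of_real ((norm (c *\<^sub>C x))\<^sup>2) = c * cnj c * cinner x x"
    by (simp only: cinner_self[symmetric] cinner_scaleC_left cinner_scaleC_right mult_ac)
  also have "\<dots> = complex_of_real ((cmod c * norm x)\<^sup>2)"
    by (simp add: cinner_self complex_norm_square[symmetric] power_mult_distrib)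
  finally have "(norm (c *\<^sub>C x))\<^sup>2 = (cmod c * norm x)\<^sup>2"
    by (simp only: of_real_eq_iff)
  then show ?thesis
    by simp
qed

instantiation complex :: complex_hilbert
begin
definition scaleC_complex :: "complex \<Rightarrow> complex \<Rightarrow> complex" where "scaleC_complex c z = c * z"
definition cinner_complex :: "complex \<Rightarrow> complex \<Rightarrow> complex" where "cinner_complex z w = z * cnj w"
instance
  by standard
    (auto simp: scaleC_complex_def cinner_complex_def algebra_simps scaleR_conv_of_real
      inner_complex_def)
end

text \<open>For a Hilbert space \<open>'a\<close> and a finite index type \<open>'n\<close> with \<open>n\<close> elements, \<open>'a ^ 'n\<close> is the
  Hilbert space \<open>\<ell>\<^sub>2\<^sup>n('a)\<close>: the library's norm on it is the \<open>\<ell>\<^sub>2\<close>-sum of the norms of the components.\<close>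

instantiation vec :: (complex_hilbert, finite) complex_hilbert
begin
definition scaleC_vec :: "complex \<Rightarrow> 'a ^ 'b \<Rightarrow> 'a ^ 'b" where
  "scaleC_vec c x = (\<chi> i. c *\<^sub>C x $ i)"
definition cinner_vec :: "'a ^ 'b \<Rightarrow> 'a ^ 'b \<Rightarrow> complex" where
  "cinner_vec x y = (\<Sum>i\<in>UNIV. cinner (x $ i) (y $ i))"
instance
proof
  fix x y z :: "'a ^ 'b" and c d :: complex and r :: real
  show "c *\<^sub>C (x + y) = c *\<^sub>C x + c *\<^sub>C y" "(c + d) *\<^sub>C x = c *\<^sub>C x + d *\<^sub>C x"
    "c *\<^sub>C d *\<^sub>C x = (c * d) *\<^sub>C x" "complex_of_real r *\<^sub>C x = r *\<^sub>R x"
    by (simp_all add: scaleC_vec_def vec_eq_iff scaleC_add_right scaleC_add_left scaleC_scaleC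
        scaleC_of_real)
  show "cinner x y = cnj (cinner y x)"
    unfolding cinner_vec_def cnj_sum by (intro sum.cong refl cinner_commute)
  show "cinner (x + y) z = cinner x z + cinner y z" "cinner (c *\<^sub>C x) y = c * cinner x y"
    by (simp_all add: cinner_vec_def scaleC_vec_def cinner_add_left cinner_scaleC_left
        sum.distrib sum_distrib_left)
  show "Re (cinner x y) = inner x y"
    by (simp add: cinner_vec_def inner_vec_def Re_cinner)
qed
end

section \<open>Bounded operators\<close>

lemma bounded_linear_scaleC: "bounded_linear (\<lambda>x::'a::complex_hilbert. c *\<^sub>C x)"
proof
  show "c *\<^sub>C (x + y) = c *\<^sub>C x + c *\<^sub>C y" for x y :: 'a
    by (rule scaleC_add_right)
  show "c *\<^sub>C (r *\<^sub>R x) = r *\<^sub>R (c *\<^sub>C x)" for r and x :: 'a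
    by (simp add: scaleC_of_real[symmetric] scaleC_scaleC mult.commute)
  show "\<exists>K. \<forall>x::'a. norm (c *\<^sub>C x) \<le> norm x * K"
    by (rule exI[of _ "cmod c"]) (simp add: norm_scaleC mult.commute)
qed

instantiation blinfun :: (real_normed_vector, complex_hilbert) complex_vector
begin
lift_definition scaleC_blinfun :: "complex \<Rightarrow> 'a \<Rightarrow>\<^sub>L 'b \<Rightarrow> 'a \<Rightarrow>\<^sub>L 'b" is "\<lambda>c T x. c *\<^sub>C T x"
  by (rule bounded_linear_compose[OF bounded_linear_scaleC])
instance
  by standard
    (transfer, simp add: scaleC_add_right scaleC_add_left scaleC_scaleC scaleC_of_real fun_eq_iff)+
end

text \<open>\<open>'h \<Rightarrow>\<^sub>L 'h\<close> consists of the bounded real-linear operators with the operator norm; \<open>B('h)\<close> is its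
  subspace of complex-linear operators.\<close>

definition bop :: "('h::complex_hilbert \<Rightarrow>\<^sub>L 'h) set" where
  "bop = {T. \<forall>c x. blinfun_apply T (c *\<^sub>C x) = c *\<^sub>C blinfun_apply T x}"

text \<open>The normal functionals on \<open>B('h)\<close>, i.e. the elements of the predual (trace class
  operators).\<close>

definition predual :: "(('h::complex_hilbert \<Rightarrow>\<^sub>L 'h) \<Rightarrow> complex) set" where
  "predual = {\<phi>. \<exists>\<xi> \<eta> :: nat \<Rightarrow> 'h.
     summable (\<lambda>n. (norm (\<xi> n))\<^sup>2) \<and> summable (\<lambda>n. (norm (\<eta> n))\<^sup>2) \<and>
     \<phi> = (\<lambda>T. \<Sum>n. cinner (blinfun_apply T (\<xi> n)) (\<eta> n))}"

definition weak_star :: "('h::complex_hilbert \<Rightarrow>\<^sub>L 'h) topology" where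
  "weak_star = topology_generated_by {{T \<in> bop. \<phi> T \<in> U} | \<phi> U. \<phi> \<in> predual \<and> open U}"

section \<open>Projection constants\<close>

text \<open>Maps on \<open>B('h)\<close> are functions on \<open>'h \<Rightarrow>\<^sub>L 'h\<close> of which only the values on \<open>bop\<close> matter.\<close>

definition projection_onto ::
    "('h::complex_hilbert \<Rightarrow>\<^sub>L 'h) set \<Rightarrow> (('h \<Rightarrow>\<^sub>L 'h) \<Rightarrow> ('h \<Rightarrow>\<^sub>L 'h)) \<Rightarrow> bool" where
  "projection_onto S P \<longleftrightarrow>
     (\<forall>T\<in>bop. \<forall>R\<in>bop. P (T + R) = P T + P R) \<and>
     (\<forall>c. \<forall>T\<in>bop. P (c *\<^sub>C T) = c *\<^sub>C P T) \<and>
     P ` bop \<subseteq> S \<and> (\<forall>T\<in>S. P T = T)"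

definition map_norm :: "(('h::complex_hilbert \<Rightarrow>\<^sub>L 'h) \<Rightarrow> ('h \<Rightarrow>\<^sub>L 'h)) \<Rightarrow> ereal" where
  "map_norm P = (SUP T\<in>{T\<in>bop. norm T \<le> 1}. ereal (norm (P T)))"

text \<open>The norm of \<open>(x i j)\<^sub>i\<^sub>,\<^sub>j\<^sub><\<^sub>n\<close> as an operator on \<open>\<ell>\<^sub>2\<^sup>n('h)\<close>. Here \<open>n\<close> is a natural number, not
  a type, since the completely bounded norm is a supremum over all \<open>n\<close>.\<close>

definition mat_norm :: "nat \<Rightarrow> (nat \<Rightarrow> nat \<Rightarrow> ('h::complex_hilbert \<Rightarrow>\<^sub>L 'h)) \<Rightarrow> real" where
  "mat_norm n x =
     (SUP \<xi>\<in>{\<xi> :: nat \<Rightarrow> 'h. sqrt (\<Sum>i<n. (norm (\<xi> i))\<^sup>2) \<le> 1}.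
        sqrt (\<Sum>i<n. (norm (\<Sum>j<n. blinfun_apply (x i j) (\<xi> j)))\<^sup>2))"

text \<open>The norm of \<open>I\<^bsub>M\<^sub>n\<^esub> \<otimes> P\<close>.\<close>

definition amp_norm :: "nat \<Rightarrow> (('h::complex_hilbert \<Rightarrow>\<^sub>L 'h) \<Rightarrow> ('h \<Rightarrow>\<^sub>L 'h)) \<Rightarrow> ereal" where
  "amp_norm n P =
     (SUP x\<in>{x. (\<forall>i<n. \<forall>j<n. x i j \<in> bop) \<and> mat_norm n x \<le> 1}.
        ereal (mat_norm n (\<lambda>i j. P (x i j))))"

definition cb_norm :: "(('h::complex_hilbert \<Rightarrow>\<^sub>L 'h) \<Rightarrow> ('h \<Rightarrow>\<^sub>L 'h)) \<Rightarrow> ereal" where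
  "cb_norm P = (SUP n\<in>{1..}. amp_norm n P)"

definition lambda :: "('h::complex_hilbert \<Rightarrow>\<^sub>L 'h) set \<Rightarrow> ereal" where
  "lambda S = Inf {ereal c | c. \<exists>P. projection_onto S P \<and> map_norm P \<le> ereal c}"

definition lambda_n :: "nat \<Rightarrow> ('h::complex_hilbert \<Rightarrow>\<^sub>L 'h) set \<Rightarrow> ereal" where
  "lambda_n n S = Inf {ereal c | c. \<exists>P. projection_onto S P \<and> amp_norm n P \<le> ereal c}"

definition lambda_cb :: "('h::complex_hilbert \<Rightarrow>\<^sub>L 'h) set \<Rightarrow> ereal" where
  "lambda_cb S = Inf {ereal c | c. \<exists>P. projection_onto S P \<and> cb_norm P \<le> ereal c}"

section \<open>Matrix spaces and tensor products\<close>

text \<open>\<open>M\<^sub>n(S)\<close> as a space of operators on \<open>\<ell>\<^sub>2\<^sup>n('h)\<close>, where \<open>n = CARD('n)\<close>: the operators whose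
  matrix has its entries in \<open>S\<close>.\<close>

definition matrix_space ::
    "('h::complex_hilbert \<Rightarrow>\<^sub>L 'h) set \<Rightarrow> (('h ^ 'n::finite) \<Rightarrow>\<^sub>L ('h ^ 'n)) set" where
  "matrix_space S =
     {T \<in> bop. \<exists>x. (\<forall>i j. x i j \<in> S) \<and>
        (\<forall>\<xi> i. blinfun_apply T \<xi> $ i = (\<Sum>j\<in>UNIV. blinfun_apply (x i j) (\<xi> $ j)))}"

text \<open>\<open>'t\<close> together with \<open>(k, h) \<mapsto> k \<otimes> h\<close> is the Hilbert space tensor product of \<open>'k\<close> and \<open>'h\<close>, which
  these properties determine up to a unique unitary compatible with the elementary tensors.\<close>

definition hilbert_tensor ::
    "('k::complex_hilbert \<Rightarrow> 'h::complex_hilbert \<Rightarrow> 't::complex_hilbert) \<Rightarrow> bool" where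
  "hilbert_tensor tens \<longleftrightarrow>
     (\<forall>k k' h. tens (k + k') h = tens k h + tens k' h) \<and>
     (\<forall>k h h'. tens k (h + h') = tens k h + tens k h') \<and>
     (\<forall>c k h. tens (c *\<^sub>C k) h = c *\<^sub>C tens k h) \<and>
     (\<forall>c k h. tens k (c *\<^sub>C h) = c *\<^sub>C tens k h) \<and>
     (\<forall>k k' h h'. cinner (tens k h) (tens k' h') = cinner k k' * cinner h h') \<and>
     closure (cspan {tens k h | k h. True}) = UNIV"

lemma hilbert_tensor_vec:
  "hilbert_tensor (\<lambda>(k :: complex ^ 'n::finite) (h :: 'h::complex_hilbert). \<chi> i. k $ i *\<^sub>C h)"
  (is "hilbert_tensor ?t")
proof -
  have "x \<in> cspan {?t k h | k h. True}" for x
  proof -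
    have "x = (\<Sum>i\<in>UNIV. ?t (axis i 1) (x $ i))"
      by (simp add: vec_eq_iff axis_def if_distrib[of "\<lambda>c. c *\<^sub>C _"] cong: if_cong)
    also have "\<dots> \<in> cspan {?t k h | k h. True}"
      by (intro complex_vector.span_sum complex_vector.span_base) auto
    finally show ?thesis .
  qed
  then have "cspan {?t k h | k h. True} = UNIV"
    by blast
  then show ?thesis
    by (simp add: hilbert_tensor_def vec_eq_iff scaleC_add_left scaleC_add_right scaleC_scaleC
        scaleC_vec_def cinner_vec_def scaleC_complex_def cinner_complex_def cinner_scaleC_left
        cinner_scaleC_right sum_distrib_left sum_distrib_right mult_ac)
qed

text \<open>\<open>a \<otimes> x\<close> on the Hilbert space tensor product: the (unique) \<open>T \<in> B('t)\<close> with
  \<open>T (k \<otimes> h) = a k \<otimes> x h\<close>.\<close>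

definition is_op_tensor where
  "is_op_tensor (tens :: 'k::complex_hilbert \<Rightarrow> 'h::complex_hilbert \<Rightarrow> 't::complex_hilbert) a x T \<longleftrightarrow>
     T \<in> bop \<and>
     (\<forall>k h. blinfun_apply T (tens k h) = tens (blinfun_apply a k) (blinfun_apply x h))"

text \<open>\<open>B('k) \<otimes> S\<close> (norm closure of the algebraic tensor product) and its weak-* closure.\<close>

definition min_tensor ::
    "('k::complex_hilbert \<Rightarrow> 'h::complex_hilbert \<Rightarrow> 't::complex_hilbert) \<Rightarrow>
     ('h \<Rightarrow>\<^sub>L 'h) set \<Rightarrow> ('t \<Rightarrow>\<^sub>L 't) set" where
  "min_tensor tens S = closure (cspan {T. \<exists>a\<in>bop. \<exists>x\<in>S. is_op_tensor tens a x T})"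

definition weak_star_tensor ::
    "('k::complex_hilbert \<Rightarrow> 'h::complex_hilbert \<Rightarrow> 't::complex_hilbert) \<Rightarrow>
     ('h \<Rightarrow>\<^sub>L 'h) set \<Rightarrow> ('t \<Rightarrow>\<^sub>L 't) set" where
  "weak_star_tensor tens S = weak_star closure_of (min_tensor tens S)"

end

theory Submission
  imports Defs
begin

text \<open>Let \<open>J\<^sub>1, \<dots>, J\<^sub>n : H \<rightarrow> K\<close> be isometries with orthogonal ranges. A projection \<open>P\<close> onto \<open>S\<close>
  yields the map \<open>y \<mapsto> \<Sum> J\<^sub>i P(J\<^sub>i\<^sup>* y J\<^sub>j) J\<^sub>j\<^sup>*\<close> on \<open>B(K)\<close>, of norm at most that of \<open>I \<otimes> P\<close>.
  Conversely, a projection \<open>Q\<close> of \<open>B(K)\<close> onto a space compatible with the \<open>J\<^sub>i\<close> yields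
  \<open>P(a) = n\<^sup>-\<^sup>2 \<Sum> J\<^sub>i\<^sup>* Q(J\<^sub>i a J\<^sub>j\<^sup>*) J\<^sub>j\<close>, and \<open>I \<otimes> P\<close> is the average of the maps
  \<open>x \<mapsto> u\<^sup>* Q(u x v\<^sup>*) v\<close> over the Weyl unitaries \<open>u, v\<close> of \<open>M\<^sub>n\<close>. With \<open>K = \<ell>\<^sub>2\<^sup>n(H)\<close> this is (i);
  with \<open>J\<^sub>i h = e\<^sub>i \<otimes> h\<close> it bounds \<open>\<lambda>\<^sub>n(S)\<close> by the constants of the tensor products. If \<open>S\<close> is
  weak-* closed, Banach--Alaoglu provides limits of projections: of almost optimal ones for
  \<open>\<lambda>\<^sub>n(S)\<close> as \<open>n \<rightarrow> \<infinity>\<close>, and of the amplifications of a fixed \<open>P\<close> along the finite subsets of an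
  orthonormal basis.\<close>

section \<open>Hilbert space geometry\<close>

text \<open>An entry of \<open>Q(y)\<close> may depend on all entries of \<open>y\<close>, so
  although a single corner of \<open>Q\<close> is already a projection onto \<open>S\<close> of norm
  at most that of \<open>Q\<close>, nothing bounds its amplification. Averaging over unitaries
  \<open>u\<close> and \<open>v\<close> chosen independently on the two sides removes every mixed
  term, and what remains acts on each entry by one and the same map. The Weyl unitaries form a
  finite family with this property, so no invariant integral is needed, and n^2 is just the number
  of corners (i, j). The projections found for different n are unrelated, whereas
  \<open>lambda_cb\<close> asks for a single one; this gap is what forces a compactness argument.
  Limits exist only in the weak operator sense, so weak-* closedness of \<open>S\<close> is what
  keeps them in \<open>S\<close>. The same effect separates the two tensor products: the finite
  amplifications take values in the norm closed one, but their limit is only known to lie in the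
  weak-* closure. Hence an inequality for the first and an equality for the second.\<close>

lemma cinner_add_right: "cinner x (y + z) = cinner x y + cinner x z"
  by (subst (1 2 3) cinner_commute) (simp add: cinner_add_left)

lemma cinner_zero_left [simp]: "cinner 0 y = 0"
  using cinner_add_left[of 0 0 y] by simp

lemma cinner_zero_right [simp]: "cinner x 0 = 0"
  using cinner_add_right[of x 0 0] by simp

lemma cinner_minus_left: "cinner (- x) y = - cinner x y"
  using cinner_add_left[of "- x" x y] by (simp add: eq_neg_iff_add_eq_0)

lemma cinner_minus_right: "cinner x (- y) = - cinner x y"
  using cinner_add_right[of x "- y" y] by (simp add: eq_neg_iff_add_eq_0)

lemma cinner_diff_left: "cinner (x - y) z = cinner x z - cinner y z"
  using cinner_add_left[of x "- y" z] by (simp add: cinner_minus_left)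

lemma cinner_diff_right: "cinner x (y - z) = cinner x y - cinner x z"
  using cinner_add_right[of x y "- z"] by (simp add: cinner_minus_right)

lemma cinner_sum_left: "cinner (\<Sum>i\<in>A. f i) y = (\<Sum>i\<in>A. cinner (f i) y)"
  by (induction A rule: infinite_finite_induct) (simp_all add: cinner_add_left)

lemma cinner_sum_right: "cinner x (\<Sum>i\<in>A. f i) = (\<Sum>i\<in>A. cinner x (f i))"
  by (induction A rule: infinite_finite_induct) (simp_all add: cinner_add_right)

lemma cinner_self_eq_0 [simp]: "cinner x x = 0 \<longleftrightarrow> x = 0"
  by (simp add: cinner_self)

lemma cinner_ext:
  assumes "\<And>y. cinner x y = cinner x' y"
  shows "x = x'"
  using cinner_self_eq_0[of "x - x'"] assms[of "x - x'"] by (simp add: cinner_diff_left)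

lemma scaleC_one [simp]: "1 *\<^sub>C x = (x :: 'a::complex_vector)"
  using scaleC_of_real[of 1 x] by simp

lemma scaleC_zero_left [simp]: "0 *\<^sub>C x = (0 :: 'a::complex_vector)"
  using scaleC_of_real[of 0 x] by simp

text \<open>Multiplying \<open>x\<close> by a phase makes the complex inner product real and
  nonnegative, so that it agrees with the real one and the real Cauchy-Schwarz inequality
  applies.\<close>

lemma cmod_cinner_le: "cmod (cinner x y) \<le> norm x * norm y"
proof (cases "cinner x y = 0")
  case False
  define c where "c = cnj (sgn (cinner x y))"
  have "cmod c = 1"
    using False by (simp add: c_def norm_sgn)
  have "c * cinner x y = cmod (cinner x y)"
    using False
    by (simp add: c_def sgn_div_norm scaleR_conv_of_real complex_norm_square[symmetric] field_simps)
      (simp add: power2_eq_square[symmetric] complex_norm_square[symmetric] mult.commute)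
  then have "cinner (c *\<^sub>C x) y = cmod (cinner x y)"
    by (simp add: cinner_scaleC_left)
  then have "cmod (cinner x y) = inner (c *\<^sub>C x) y"
    by (metis Re_cinner Re_complex_of_real)
  also have "\<dots> \<le> norm (c *\<^sub>C x) * norm y"
    by (rule norm_cauchy_schwarz)
  finally show ?thesis
    using \<open>cmod c = 1\<close> by (simp add: norm_scaleC)
qed simp

lemma bounded_linear_cinner_right: "bounded_linear (\<lambda>y. cinner x y)"
proof
  show "cinner x (r *\<^sub>R y) = r *\<^sub>R cinner x y" for r y
    using cinner_scaleC_right[of x "of_real r" y] by (simp add: scaleC_of_real scaleR_conv_of_real)
  show "\<exists>K. \<forall>y. norm (cinner x y) \<le> norm y * K"
    using cmod_cinner_le by (metis mult.commute)
qed (simp add: cinner_add_right)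

lemma norm_le_of_cinner_le:
  assumes "0 \<le> c" "\<And>y. cmod (cinner x y) \<le> c * norm y"
  shows "norm x \<le> c"
proof (cases "x = 0")
  case False
  have "cmod (cinner x x) = (norm x)\<^sup>2"
    by (simp add: cinner_self norm_power)
  then have "norm x * norm x \<le> c * norm x"
    using assms(2)[of x] by (simp add: power2_eq_square)
  then show ?thesis
    using False by simp
qed (use assms in simp)

text \<open>By the parallelogram law, and because midpoints stay in \<open>M\<close>, two points of
  \<open>M\<close> that nearly attain the distance are close to each other. A minimising sequence is
  therefore Cauchy.\<close>

lemma closest_point_exists:
  fixes M :: "'a::{real_inner, complete_space} set"
  assumes "closed M" "convex M" "M \<noteq> {}"
  obtains m where "m \<in> M" "\<And>y. y \<in> M \<Longrightarrow> norm (x - m) \<le> norm (x - y)"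
proof -
  define d where "d = infdist x M"
  have dle: "d \<le> norm (x - y)" if "y \<in> M" for y
    using infdist_le[OF that, of x] by (simp add: d_def dist_norm)
  have d0: "0 \<le> d"
    by (simp add: d_def infdist_nonneg)
  have "\<exists>y\<in>M. norm (x - y) < d + inverse (Suc k)" for k
  proof -
    have "Inf (dist x ` M) < d + inverse (Suc k)"
      using \<open>M \<noteq> {}\<close> by (simp add: d_def infdist_def)
    then show ?thesis
      using \<open>M \<noteq> {}\<close> cInf_lessD[of "dist x ` M" "d + inverse (Suc k)"] by (auto simp: dist_norm)
  qed
  then obtain s where sM: "\<And>k. s k \<in> M" and s: "\<And>k. norm (x - s k) < d + inverse (Suc k)"
    by metis
  have par: "(norm (a - b))\<^sup>2 \<le> 2 * (norm (x - a))\<^sup>2 + 2 * (norm (x - b))\<^sup>2 - 4 * d\<^sup>2"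
    if "a \<in> M" "b \<in> M" for a b
  proof -
    have "(1/2) *\<^sub>R a + (1/2) *\<^sub>R b \<in> M"
      using \<open>convex M\<close> that by (simp add: convex_def)
    then have "d\<^sup>2 \<le> (norm (x - ((1/2) *\<^sub>R a + (1/2) *\<^sub>R b)))\<^sup>2"
      using dle d0 by (simp add: power_mono)
    moreover have "(norm (a - b))\<^sup>2 + 4 * (norm (x - ((1/2) *\<^sub>R a + (1/2) *\<^sub>R b)))\<^sup>2
        = 2 * (norm (x - a))\<^sup>2 + 2 * (norm (x - b))\<^sup>2"
      by (simp add: power2_norm_eq_inner inner_simps inner_commute algebra_simps)
    ultimately show ?thesis
      by linarith
  qed
  have lim: "(\<lambda>k. norm (x - s k)) \<longlonglongrightarrow> d"
  proof (rule tendsto_sandwich[OF _ _ tendsto_const])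
    show "(\<lambda>k. d + inverse (Suc k)) \<longlonglongrightarrow> d"
      using tendsto_add[OF tendsto_const LIMSEQ_inverse_real_of_nat] by simp
    show "\<forall>\<^sub>F k in sequentially. norm (x - s k) \<le> d + inverse (Suc k)"
      using s less_imp_le by (intro always_eventually) blast
  qed (use dle sM in simp)
  have "Cauchy s"
  proof (rule metric_CauchyI)
    fix e :: real
    assume "0 < e"
    have "(\<lambda>k. (norm (x - s k))\<^sup>2) \<longlonglongrightarrow> d\<^sup>2"
      by (intro tendsto_power lim)
    then obtain N where N: "\<And>k. k \<ge> N \<Longrightarrow> (norm (x - s k))\<^sup>2 < d\<^sup>2 + e\<^sup>2 / 4"
      using order_tendstoD(2)[of _ "d\<^sup>2" sequentially "d\<^sup>2 + e\<^sup>2 / 4"] \<open>0 < e\<close>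
      by (auto simp: eventually_sequentially)
    show "\<exists>M. \<forall>m\<ge>M. \<forall>n\<ge>M. dist (s m) (s n) < e"
    proof (intro exI allI impI)
      fix m n
      assume "N \<le> m" "N \<le> n"
      then have "(norm (s m - s n))\<^sup>2 < e\<^sup>2"
        using par[OF sM sM, of m n] N[of m] N[of n] by linarith
      then show "dist (s m) (s n) < e"
        using \<open>0 < e\<close> by (simp add: dist_norm power_less_imp_less_base)
    qed
  qed
  then obtain m where m: "s \<longlonglongrightarrow> m"
    by (auto simp: Cauchy_convergent_iff convergent_def)
  have "m \<in> M"
    using closed_sequentially[OF \<open>closed M\<close>] m sM by blast
  moreover have "(\<lambda>k. norm (x - s k)) \<longlonglongrightarrow> norm (x - m)"
    by (intro tendsto_intros m)
  then have "norm (x - m) = d"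
    using lim LIMSEQ_unique by blast
  ultimately show ?thesis
    using that dle by metis
qed

text \<open>The closest point works: if \<open>a = cinner (x - m) y\<close> were nonzero, moving
  \<open>m\<close> by \<open>a / (norm y)^2\<close> times \<open>y\<close> would lower the squared
  distance by \<open>(cmod a)^2 / (norm y)^2\<close>.\<close>

lemma orthogonal_projection_exists:
  fixes M :: "'a::complex_hilbert set"
  assumes "closed M" "csubspace M"
  obtains m where "m \<in> M" "\<And>y. y \<in> M \<Longrightarrow> cinner (x - m) y = 0"
proof -
  have scR: "r *\<^sub>R y \<in> M" if "y \<in> M" for r y
    using complex_vector.subspace_scale[OF assms(2) that, of "of_real r"] by (simp add: scaleC_of_real)
  have "convex M"
    using scR complex_vector.subspace_add[OF assms(2)] by (simp add: convex_def)
  moreover have "M \<noteq> {}"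
    using complex_vector.subspace_0[OF assms(2)] by blast
  ultimately obtain m where m: "m \<in> M" and min: "\<And>y. y \<in> M \<Longrightarrow> norm (x - m) \<le> norm (x - y)"
    using closest_point_exists assms(1) by metis
  have "cinner (x - m) y = 0" if "y \<in> M" for y
  proof (cases "y = 0")
    case False
    define a where "a = cinner (x - m) y"
    define t where "t = a / of_real ((norm y)\<^sup>2)"
    have "m + t *\<^sub>C y \<in> M"
      using m that assms(2) complex_vector.subspace_add complex_vector.subspace_scale by blast
    from min[OF this] have "(norm (x - m))\<^sup>2 \<le> (norm ((x - m) - t *\<^sub>C y))\<^sup>2"
      by (simp add: power_mono algebra_simps)
    moreover have "cinner ((x - m) - t *\<^sub>C y) ((x - m) - t *\<^sub>C y)
        = cinner (x - m) (x - m) - of_real ((cmod a)\<^sup>2 / (norm y)\<^sup>2)"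
    proof -
      have 1: "cinner (x - m) (t *\<^sub>C y) = cnj t * a"
        by (simp only: a_def cinner_scaleC_right)
      have 2: "cinner (t *\<^sub>C y) (x - m) = t * cnj a"
        by (simp only: a_def cinner_scaleC_left cinner_commute[of "x - m" y] complex_cnj_cnj)
      have "cnj t * cinner y y = cnj a"
        using False by (simp add: t_def cinner_self)
      then have 3: "cinner (t *\<^sub>C y) (t *\<^sub>C y) = t * cnj a"
        by (simp add: cinner_scaleC_left cinner_scaleC_right)
      have 4: "cnj t * a = of_real ((cmod a)\<^sup>2 / (norm y)\<^sup>2)"
        unfolding t_def of_real_divide complex_norm_square by simp
      have 5: "t * cnj a = of_real ((cmod a)\<^sup>2 / (norm y)\<^sup>2)"
        unfolding t_def of_real_divide complex_norm_square by simp
      have "cinner (u - v) (u - v) = cinner u u - cinner u v - cinner v u + cinner v v" for u v :: 'a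
        by (simp add: cinner_diff_left cinner_diff_right)
      from this[of "x - m" "t *\<^sub>C y"] show ?thesis
        unfolding 1 2 3 4 5 by (simp only: diff_add_cancel)
    qed
    then have "(norm ((x - m) - t *\<^sub>C y))\<^sup>2 = (norm (x - m))\<^sup>2 - (cmod a)\<^sup>2 / (norm y)\<^sup>2"
      unfolding cinner_self of_real_diff[symmetric] of_real_eq_iff .
    ultimately have "(cmod a)\<^sup>2 / (norm y)\<^sup>2 \<le> 0"
      by linarith
    then have "cmod a = 0"
      using False by (simp add: divide_le_0_iff)
    then show ?thesis
      by (simp add: a_def)
  qed simp
  with m show ?thesis
    using that by blast
qed

text \<open>Take \<open>w\<close> nonzero and orthogonal to the kernel. The vector
  \<open>f w *\<^sub>C x - f x *\<^sub>C w\<close> lies in the kernel, and its orthogonality to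
  \<open>w\<close> expresses \<open>f x\<close> through \<open>cinner x w\<close>.\<close>

lemma riesz_representation:
  fixes f :: "'a::complex_hilbert \<Rightarrow> complex"
  assumes "bounded_linear f" and homog: "\<And>c x. f (c *\<^sub>C x) = c * f x"
  obtains z where "\<And>x. f x = cinner x z"
proof (cases "\<forall>x. f x = 0")
  case True
  then show ?thesis
    using that[of 0] by simp
next
  case False
  then obtain x0 where x0: "f x0 \<noteq> 0"
    by blast
  interpret bounded_linear f by fact
  define M where "M = {x. f x = 0}"
  have "closed M"
    unfolding M_def by (rule closed_Collect_eq[OF continuous_on[OF continuous_on_id] continuous_on_const])
  moreover have "csubspace M"
    by (auto simp: M_def complex_vector.subspace_def add homog zero)
  ultimately obtain m where m: "m \<in> M" and orth: "\<And>y. y \<in> M \<Longrightarrow> cinner (x0 - m) y = 0"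
    using orthogonal_projection_exists by metis
  define w where "w = x0 - m"
  have fw: "f w = f x0"
    using m by (simp add: w_def diff M_def)
  then have "w \<noteq> 0"
    using x0 zero by force
  define z where "z = cnj (f w / cinner w w) *\<^sub>C w"
  have "f x = cinner x z" for x
  proof -
    have "f w *\<^sub>C x - f x *\<^sub>C w \<in> M"
      by (simp add: M_def diff homog)
    then have "cinner (f w *\<^sub>C x - f x *\<^sub>C w) w = 0"
      using orth w_def by (metis cinner_commute complex_cnj_zero)
    then have "f w * cinner x w = f x * cinner w w"
      by (simp add: cinner_diff_left cinner_scaleC_left)
    then show ?thesis
      using \<open>w \<noteq> 0\<close> by (simp add: z_def cinner_scaleC_right field_simps)
  qed
  then show ?thesis
    using that by blast
qed

section \<open>Complex-linear operators, sesquilinear forms and adjoints\<close>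

definition clin :: "('a::complex_hilbert \<Rightarrow>\<^sub>L 'b::complex_hilbert) \<Rightarrow> bool" where
  "clin A \<longleftrightarrow> (\<forall>c x. A (c *\<^sub>C x) = c *\<^sub>C A x)"

lemma bop_eq_clin: "bop = {T. clin T}"
  by (simp add: bop_def clin_def)

text \<open>The Riesz theorem is applied for fixed \<open>x\<close> to the conjugate of
  \<open>B x y\<close>, which is linear in \<open>y\<close>. The lemma produces adjoints, and later
  turns limits of matrix coefficients back into operators.\<close>

lemma sesquilinear_form_operator:
  fixes B :: "'a::complex_hilbert \<Rightarrow> 'b::complex_hilbert \<Rightarrow> complex"
  assumes "0 \<le> c" and bound: "\<And>x y. cmod (B x y) \<le> c * norm x * norm y"
    and add_left: "\<And>x x' y. B (x + x') y = B x y + B x' y"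
    and scale_left: "\<And>a x y. B (a *\<^sub>C x) y = a * B x y"
    and add_right: "\<And>x y y'. B x (y + y') = B x y + B x y'"
    and scale_right: "\<And>a x y. B x (a *\<^sub>C y) = cnj a * B x y"
  obtains T where "clin T" "\<And>x y. cinner (blinfun_apply T x) y = B x y" "norm T \<le> c"
proof -
  have "\<exists>z. \<forall>y. cnj (B x y) = cinner y z" for x
  proof -
    have "bounded_linear (\<lambda>y. cnj (B x y))"
    proof
      show "\<exists>K. \<forall>y. norm (cnj (B x y)) \<le> norm y * K"
        using bound[of x] by (intro exI[of _ "c * norm x"]) (simp add: mult.commute)
      show "cnj (B x (r *\<^sub>R y)) = r *\<^sub>R cnj (B x y)" for r y
        using scale_right[of x "of_real r" y] by (simp add: scaleC_of_real scaleR_conv_of_real)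
    qed (simp add: add_right)
    then show ?thesis
      by (rule riesz_representation) (auto simp: scale_right)
  qed
  then obtain t where "\<And>x y. cnj (B x y) = cinner y (t x)"
    by metis
  then have t: "cinner (t x) y = B x y" for x y
    by (metis cinner_commute complex_cnj_cnj)
  have bnd: "norm (t x) \<le> c * norm x" for x
    by (rule norm_le_of_cinner_le) (simp_all add: t bound \<open>0 \<le> c\<close>)
  have tsc: "t (a *\<^sub>C x) = a *\<^sub>C t x" for a x
    by (rule cinner_ext) (simp add: t scale_left cinner_scaleC_left)
  have "bounded_linear t"
  proof
    show "t (x + y) = t x + t y" for x y
      by (rule cinner_ext) (simp add: t add_left cinner_add_left)
    show "t (r *\<^sub>R x) = r *\<^sub>R t x" for r x
      using tsc[of "of_real r"] by (simp add: scaleC_of_real)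
    show "\<exists>K. \<forall>x. norm (t x) \<le> norm x * K"
      using bnd by (metis mult.commute)
  qed
  then have app: "blinfun_apply (Blinfun t) = t"
    by (rule bounded_linear_Blinfun_apply)
  show ?thesis
  proof (rule that[of "Blinfun t"])
    show "norm (Blinfun t) \<le> c"
      by (rule norm_blinfun_bound) (use \<open>0 \<le> c\<close> bnd in \<open>simp_all add: app\<close>)
  qed (simp_all add: clin_def app t tsc)
qed

text \<open>An adjoint in this sense exists exactly for complex-linear \<open>A\<close>. The choice
  operator makes the function total, so its rules carry the hypothesis
  \<open>clin A\<close>.\<close>

definition adj :: "('a::complex_hilbert \<Rightarrow>\<^sub>L 'b::complex_hilbert) \<Rightarrow> 'b \<Rightarrow>\<^sub>L 'a" where
  "adj A = (SOME B. clin B \<and> (\<forall>x y. cinner (blinfun_apply B y) x = cinner y (blinfun_apply A x)))"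

lemma
  assumes "clin A"
  shows clin_adj: "clin (adj A)"
    and cinner_adj_left: "cinner (adj A y) x = cinner y (A x)"
proof -
  have "\<exists>B. clin B \<and> (\<forall>x y. cinner (blinfun_apply B y) x = cinner y (blinfun_apply A x))"
  proof (rule sesquilinear_form_operator[of "norm A" "\<lambda>y x. cinner y (blinfun_apply A x)"])
    fix T :: "'b \<Rightarrow>\<^sub>L 'a"
    assume "clin T" "\<And>y x. cinner (blinfun_apply T y) x = cinner y (blinfun_apply A x)"
    then show ?thesis
      by blast
  next
    show "cmod (cinner x (blinfun_apply A y)) \<le> norm A * norm x * norm y" for x y
    proof -
      have "cmod (cinner x (blinfun_apply A y)) \<le> norm x * (norm A * norm y)"
        by (rule order_trans[OF cmod_cinner_le]) (simp add: mult_left_mono norm_blinfun)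
      then show ?thesis
        by (simp add: mult_ac)
    qed
  qed (use assms in \<open>auto simp: clin_def cinner_add_left cinner_add_right cinner_scaleC_left
        cinner_scaleC_right blinfun.add_right\<close>)
  from someI_ex[OF this] show "clin (adj A)" "cinner (adj A y) x = cinner y (A x)"
    by (simp_all add: adj_def)
qed

lemma clin_zero [simp]: "clin 0"
  by (simp add: clin_def complex_vector.scale_right_distrib)

lemma clin_compose: "clin A \<Longrightarrow> clin B \<Longrightarrow> clin (A o\<^sub>L B)"
  by (simp add: clin_def)

lemma scaleC_blinfun_apply [simp]: "blinfun_apply (c *\<^sub>C A) x = c *\<^sub>C blinfun_apply A x"
  by transfer simp

lemma csubspace_bop: "csubspace bop"
  by (auto simp: complex_vector.subspace_def bop_def blinfun.add_left scaleC_add_right scaleC_scaleC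
      mult.commute)

lemma clin_add: "clin A \<Longrightarrow> clin B \<Longrightarrow> clin (A + B)"
  by (simp add: clin_def blinfun.add_left scaleC_add_right)

lemma clin_scaleC: "clin A \<Longrightarrow> clin (c *\<^sub>C A)"
  by (simp add: clin_def scaleC_scaleC mult.commute)

lemma clin_sum: "(\<And>i. i \<in> I \<Longrightarrow> clin (f i)) \<Longrightarrow> clin (\<Sum>i\<in>I. f i)"
  by (induction I rule: infinite_finite_induct) (auto intro: clin_add)

lemma closed_bop: "closed (bop :: ('h::complex_hilbert \<Rightarrow>\<^sub>L 'h) set)"
proof -
  have *: "bop = (\<Inter>c. \<Inter>x. {T :: 'h \<Rightarrow>\<^sub>L 'h. T (c *\<^sub>C x) = c *\<^sub>C T x})"
    by (auto simp: bop_def)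
  have "closed {T :: 'h \<Rightarrow>\<^sub>L 'h. T (c *\<^sub>C x) = c *\<^sub>C T x}" for c and x :: 'h
    by (intro closed_Collect_eq continuous_intros
        bounded_linear.continuous_on[OF bounded_linear_scaleC])
  then show ?thesis
    unfolding * by (intro closed_INT ballI)
qed


section \<open>Operator matrices\<close>

definition l2n :: "nat \<Rightarrow> (nat \<Rightarrow> 'a::real_normed_vector) \<Rightarrow> real" where
  "l2n n \<xi> = L2_set (\<lambda>i. norm (\<xi> i)) {..<n}"

lemma l2n_nonneg [simp]: "0 \<le> l2n n \<xi>"
  by (simp add: l2n_def)

lemma l2n_power2: "(l2n n \<xi>)\<^sup>2 = (\<Sum>i<n. (norm (\<xi> i))\<^sup>2)"
  by (simp add: l2n_def L2_set_def sum_nonneg)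

lemma norm_le_l2n: "i < n \<Longrightarrow> norm (\<xi> i) \<le> l2n n \<xi>"
  unfolding l2n_def by (rule member_le_L2_set) auto

lemma l2n_cong: "(\<And>i. i < n \<Longrightarrow> \<xi> i = \<eta> i) \<Longrightarrow> l2n n \<xi> = l2n n \<eta>"
  by (simp add: l2n_def L2_set_def)

lemma l2n_scaleR: "l2n n (\<lambda>i. r *\<^sub>R \<xi> i) = \<bar>r\<bar> * l2n n \<xi>"
  by (simp add: l2n_def L2_set_right_distrib)

lemma cinner_sum_le_l2n: "cmod (\<Sum>i<n. cinner (\<xi> i) (\<eta> i)) \<le> l2n n \<xi> * l2n n \<eta>"
proof -
  have "cmod (\<Sum>i<n. cinner (\<xi> i) (\<eta> i)) \<le> (\<Sum>i<n. norm (\<xi> i) * norm (\<eta> i))"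
    by (intro sum_norm_le cmod_cinner_le)
  also have "\<dots> \<le> l2n n \<xi> * l2n n \<eta>"
    using L2_set_mult_ineq[of "\<lambda>i. norm (\<xi> i)" "\<lambda>i. norm (\<eta> i)" "{..<n}"] by (simp add: l2n_def)
  finally show ?thesis .
qed

definition matvec ::
    "nat \<Rightarrow> (nat \<Rightarrow> nat \<Rightarrow> 'a::real_normed_vector \<Rightarrow>\<^sub>L 'a) \<Rightarrow> (nat \<Rightarrow> 'a) \<Rightarrow> nat \<Rightarrow> 'a" where
  "matvec n x \<xi> i = (\<Sum>j<n. x i j (\<xi> j))"

lemma mat_norm_eq_SUP: "mat_norm n x = (SUP \<xi>\<in>{\<xi>. l2n n \<xi> \<le> 1}. l2n n (matvec n x \<xi>))"
  by (simp add: mat_norm_def l2n_def L2_set_def matvec_def[abs_def])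

lemma matvec_scaleR: "matvec n x (\<lambda>j. r *\<^sub>R \<xi> j) = (\<lambda>i. r *\<^sub>R matvec n x \<xi> i)"
  by (simp add: matvec_def blinfun.scaleR_right scaleR_sum_right fun_eq_iff)

text \<open>A crude bound, whose purpose is to show that the supremum in \<open>mat_norm\<close> is
  over a bounded set and that vectors of norm zero cause no trouble.\<close>

lemma l2n_matvec_le_entries: "l2n n (matvec n x \<xi>) \<le> (\<Sum>i<n. \<Sum>j<n. norm (x i j)) * l2n n \<xi>"
proof -
  have "l2n n (matvec n x \<xi>) \<le> (\<Sum>i<n. norm (matvec n x \<xi> i))"
    unfolding l2n_def by (intro order_trans[OF L2_set_le_sum]) auto
  also have "\<dots> \<le> (\<Sum>i<n. \<Sum>j<n. norm (x i j) * l2n n \<xi>)"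
    unfolding matvec_def
    by (intro sum_mono sum_norm_le order_trans[OF norm_blinfun] mult_left_mono norm_le_l2n) auto
  finally show ?thesis
    by (simp add: sum_distrib_right)
qed

lemma bdd_above_mat_norm: "bdd_above ((\<lambda>\<xi>. l2n n (matvec n x \<xi>)) ` {\<xi>. l2n n \<xi> \<le> 1})"
proof (rule bdd_aboveI2)
  fix \<xi> :: "nat \<Rightarrow> 'a"
  assume "\<xi> \<in> {\<xi>. l2n n \<xi> \<le> 1}"
  then show "l2n n (matvec n x \<xi>) \<le> (\<Sum>i<n. \<Sum>j<n. norm (x i j))"
    by (intro order_trans[OF l2n_matvec_le_entries] mult_left_le sum_nonneg) auto
qed

lemma l2n_zero [simp]: "l2n n (\<lambda>_. 0) = 0"
  by (simp add: l2n_def L2_set_def)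

lemma mat_norm_nonneg: "0 \<le> mat_norm n x"
  unfolding mat_norm_eq_SUP
  by (rule cSUP_upper2[OF bdd_above_mat_norm, of "\<lambda>_. 0"]) auto

lemma l2n_matvec_le: "l2n n (matvec n x \<xi>) \<le> mat_norm n x * l2n n \<xi>"
proof (cases "l2n n \<xi> = 0")
  case True
  then show ?thesis
    using l2n_matvec_le_entries[of n x \<xi>] by simp
next
  case False
  then have pos: "0 < l2n n \<xi>"
    by (simp add: less_le)
  let ?\<eta> = "\<lambda>j. inverse (l2n n \<xi>) *\<^sub>R \<xi> j"
  have "l2n n (matvec n x ?\<eta>) \<le> mat_norm n x"
    unfolding mat_norm_eq_SUP
    by (rule cSUP_upper[OF _ bdd_above_mat_norm]) (use pos in \<open>simp add: l2n_scaleR\<close>)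
  then show ?thesis
    using pos by (simp add: matvec_scaleR l2n_scaleR field_simps)
qed

lemma mat_norm_le:
  assumes "\<And>\<xi>. l2n n (matvec n x \<xi>) \<le> c * l2n n \<xi>" "0 \<le> c"
  shows "mat_norm n x \<le> c"
  unfolding mat_norm_eq_SUP
proof (rule cSUP_least)
  show "{\<xi> :: nat \<Rightarrow> 'a. l2n n \<xi> \<le> 1} \<noteq> {}"
    using l2n_zero by (metis (mono_tags) empty_iff mem_Collect_eq zero_le_one)
  show "l2n n (matvec n x \<xi>) \<le> c" if "\<xi> \<in> {\<xi>. l2n n \<xi> \<le> 1}" for \<xi>
    using assms(1)[of \<xi>] mult_left_le[of "l2n n \<xi>" c] assms(2) that by simp
qed

lemma cinner_matvec_le:
  "cmod (\<Sum>i<n. cinner (matvec n x \<xi> i) (\<eta> i)) \<le> mat_norm n x * l2n n \<xi> * l2n n \<eta>"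
  by (rule order_trans[OF cinner_sum_le_l2n]) (intro mult_right_mono l2n_matvec_le l2n_nonneg)

text \<open>Test the form with \<open>\<eta>\<close> equal to the image of \<open>\<xi>\<close>. A
  bound on the form, unlike a bound on norms of vectors, passes to weak operator limits
  directly.\<close>

lemma mat_norm_le_form:
  assumes "\<And>\<xi> \<eta>. cmod (\<Sum>i<n. cinner (matvec n x \<xi> i) (\<eta> i)) \<le> c * l2n n \<xi> * l2n n \<eta>" "0 \<le> c"
  shows "mat_norm n x \<le> c"
proof (rule mat_norm_le[OF _ \<open>0 \<le> c\<close>])
  fix \<xi>
  let ?\<eta> = "matvec n x \<xi>"
  have "(\<Sum>i<n. cinner (?\<eta> i) (?\<eta> i)) = of_real ((l2n n ?\<eta>)\<^sup>2)"
    by (simp add: cinner_self l2n_power2)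
  then have "(l2n n ?\<eta>)\<^sup>2 \<le> c * l2n n \<xi> * l2n n ?\<eta>"
    using assms(1)[of \<xi> ?\<eta>] by (simp del: of_real_power)
  then show "l2n n ?\<eta> \<le> c * l2n n \<xi>"
    using \<open>0 \<le> c\<close> by (cases "l2n n ?\<eta> = 0") (simp_all add: power2_eq_square less_le)
qed

lemma mat_norm_cong: "(\<And>i j. i < n \<Longrightarrow> j < n \<Longrightarrow> x i j = y i j) \<Longrightarrow> mat_norm n x = mat_norm n y"
  unfolding mat_norm_eq_SUP by (intro SUP_cong l2n_cong) (simp_all add: matvec_def)

lemma mat_norm_add_le: "mat_norm n (\<lambda>i j. x i j + y i j) \<le> mat_norm n x + mat_norm n y"
proof (rule mat_norm_le)
  fix \<xi>
  have "l2n n (matvec n (\<lambda>i j. x i j + y i j) \<xi>)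
      \<le> L2_set (\<lambda>i. norm (matvec n x \<xi> i) + norm (matvec n y \<xi> i)) {..<n}"
    unfolding l2n_def
    by (intro L2_set_mono) (simp_all add: matvec_def blinfun.add_left sum.distrib norm_triangle_ineq)
  also have "\<dots> \<le> l2n n (matvec n x \<xi>) + l2n n (matvec n y \<xi>)"
    unfolding l2n_def by (rule L2_set_triangle_ineq)
  also have "\<dots> \<le> (mat_norm n x + mat_norm n y) * l2n n \<xi>"
    using l2n_matvec_le[of n x \<xi>] l2n_matvec_le[of n y \<xi>] by (simp add: algebra_simps)
  finally show "l2n n (matvec n (\<lambda>i j. x i j + y i j) \<xi>) \<le> (mat_norm n x + mat_norm n y) * l2n n \<xi>" .
qed (simp add: mat_norm_nonneg)

lemma mat_norm_zero [simp]: "mat_norm n (\<lambda>i j. 0) = 0"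
  by (rule antisym[OF mat_norm_le mat_norm_nonneg]) (simp_all add: matvec_def[abs_def])

lemma mat_norm_sum_le: "mat_norm n (\<lambda>i j. \<Sum>g\<in>G. x g i j) \<le> (\<Sum>g\<in>G. mat_norm n (x g))"
proof (induction G rule: infinite_finite_induct)
  case (insert g G)
  then show ?case
    using mat_norm_add_le[of n "x g" "\<lambda>i j. \<Sum>g\<in>G. x g i j"] by simp
qed simp_all

lemma mat_norm_scaleR: "mat_norm n (\<lambda>i j. r *\<^sub>R x i j) = \<bar>r\<bar> * mat_norm n x"
proof -
  have le: "mat_norm n (\<lambda>i j. r *\<^sub>R x i j) \<le> \<bar>r\<bar> * mat_norm n x" for r and x :: "nat \<Rightarrow> nat \<Rightarrow> 'a \<Rightarrow>\<^sub>L 'a"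
  proof (rule mat_norm_le)
    fix \<xi>
    have "matvec n (\<lambda>i j. r *\<^sub>R x i j) \<xi> = (\<lambda>i. r *\<^sub>R matvec n x \<xi> i)"
      by (simp add: matvec_def blinfun.scaleR_left scaleR_sum_right fun_eq_iff)
    then show "l2n n (matvec n (\<lambda>i j. r *\<^sub>R x i j) \<xi>) \<le> \<bar>r\<bar> * mat_norm n x * l2n n \<xi>"
      using mult_left_mono[OF l2n_matvec_le[of n x \<xi>], of "\<bar>r\<bar>"] by (simp add: l2n_scaleR mult.assoc)
  qed (simp add: mat_norm_nonneg)
  show ?thesis
  proof (cases "r = 0")
    case False
    have "mat_norm n x = mat_norm n (\<lambda>i j. inverse r *\<^sub>R (r *\<^sub>R x i j))"
      using False by simp
    also have "\<dots> \<le> \<bar>inverse r\<bar> * mat_norm n (\<lambda>i j. r *\<^sub>R x i j)"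
      by (rule le)
    finally have "\<bar>r\<bar> * mat_norm n x \<le> mat_norm n (\<lambda>i j. r *\<^sub>R x i j)"
      using False by (simp add: field_simps)
    then show ?thesis
      using le[of r x] by simp
  qed simp
qed

section \<open>Projections and homogeneous forms of their norm bounds\<close>

lemma projection_add: "projection_onto S P \<Longrightarrow> T \<in> bop \<Longrightarrow> R \<in> bop \<Longrightarrow> P (T + R) = P T + P R"
  and projection_scaleC: "projection_onto S P \<Longrightarrow> T \<in> bop \<Longrightarrow> P (c *\<^sub>C T) = c *\<^sub>C P T"
  and projection_in: "projection_onto S P \<Longrightarrow> T \<in> bop \<Longrightarrow> P T \<in> S"
  and projection_fixes: "projection_onto S P \<Longrightarrow> T \<in> S \<Longrightarrow> P T = T"
  by (auto simp: projection_onto_def)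

lemma bop_zero [simp]: "0 \<in> bop"
  and bop_add: "T \<in> bop \<Longrightarrow> R \<in> bop \<Longrightarrow> T + R \<in> bop"
  and bop_scaleC: "T \<in> bop \<Longrightarrow> c *\<^sub>C T \<in> bop"
  by (simp_all add: bop_eq_clin clin_add clin_scaleC)

lemma bop_scaleR: "T \<in> bop \<Longrightarrow> r *\<^sub>R T \<in> bop"
  using bop_scaleC[of T "of_real r"] by (simp add: scaleC_of_real)

lemma projection_scaleR: "projection_onto S P \<Longrightarrow> T \<in> bop \<Longrightarrow> P (r *\<^sub>R T) = r *\<^sub>R P T"
  using projection_scaleC[of S P T "of_real r"] by (simp add: scaleC_of_real)

lemma projection_zero: "projection_onto S P \<Longrightarrow> P 0 = 0"
  using projection_scaleR[of S P 0 0] by simp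

lemma projection_sum:
  "projection_onto S P \<Longrightarrow> (\<And>i. i \<in> I \<Longrightarrow> f i \<in> bop) \<Longrightarrow> P (\<Sum>i\<in>I. f i) = (\<Sum>i\<in>I. P (f i))"
  by (induction I rule: infinite_finite_induct)
    (auto simp: projection_zero projection_add complex_vector.subspace_sum[OF csubspace_bop])

text \<open>Turns a bound on the unit ball into a homogeneous one; if \<open>a = 0\<close>, then \<open>r\<close> is arbitrarily large.\<close>

lemma le_mult_of_unit_ball_bound:
  fixes a b c :: real
  assumes "0 \<le> a" and "\<And>r. 0 < r \<Longrightarrow> r * a \<le> 1 \<Longrightarrow> r * b \<le> c"
  shows "b \<le> c * a"
proof (cases "a = 0")
  case True
  show ?thesis
  proof (rule ccontr)
    assume "\<not> b \<le> c * a"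
    then have "0 < b"
      using True by simp
    then have "(\<bar>c\<bar> + 1) / b * b \<le> c"
      using True assms(2)[of "(\<bar>c\<bar> + 1) / b"] by simp
    with \<open>0 < b\<close> show False
      by simp
  qed
next
  case False
  then show ?thesis
    using assms(1) assms(2)[of "inverse a"] by (simp add: field_simps)
qed

lemma map_norm_leD:
  assumes "projection_onto S P" "map_norm P \<le> ereal c"
  shows "0 \<le> c" "\<And>T. T \<in> bop \<Longrightarrow> norm (P T) \<le> c * norm T"
proof -
  have le: "norm (P T) \<le> c" if "T \<in> bop" "norm T \<le> 1" for T
    using assms(2) that unfolding map_norm_def SUP_le_iff by auto
  from le[of 0] show "0 \<le> c"
    by (simp add: projection_zero[OF assms(1)])
  show "norm (P T) \<le> c * norm T" if "T \<in> bop" for T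
  proof (rule le_mult_of_unit_ball_bound[OF norm_ge_zero])
    fix r :: real
    assume "0 < r" "r * norm T \<le> 1"
    then show "r * norm (P T) \<le> c"
      using le[OF bop_scaleR[OF that], of r] by (simp add: projection_scaleR[OF assms(1) that])
  qed
qed

lemma map_norm_leI:
  assumes "0 \<le> c" "\<And>T. T \<in> bop \<Longrightarrow> norm (P T) \<le> c * norm T"
  shows "map_norm P \<le> ereal c"
  unfolding map_norm_def
proof (rule SUP_least, simp)
  fix T :: "'a \<Rightarrow>\<^sub>L 'a"
  assume "T \<in> bop \<and> norm T \<le> 1"
  then show "norm (P T) \<le> c"
    using assms(2)[of T] mult_left_le[of "norm T" c] \<open>0 \<le> c\<close> by simp
qed

lemma amp_norm_leD:
  assumes "projection_onto S P" "amp_norm n P \<le> ereal c"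
  shows "0 \<le> c"
    and "\<And>x. (\<And>i j. i < n \<Longrightarrow> j < n \<Longrightarrow> x i j \<in> bop) \<Longrightarrow> mat_norm n (\<lambda>i j. P (x i j)) \<le> c * mat_norm n x"
proof -
  have le: "mat_norm n (\<lambda>i j. P (x i j)) \<le> c" if "\<forall>i<n. \<forall>j<n. x i j \<in> bop" "mat_norm n x \<le> 1" for x
    using assms(2) that unfolding amp_norm_def SUP_le_iff by auto
  from le[of "\<lambda>i j. 0"] show "0 \<le> c"
    by (simp add: projection_zero[OF assms(1)])
  fix x :: "nat \<Rightarrow> nat \<Rightarrow> 'a \<Rightarrow>\<^sub>L 'a"
  assume x: "\<And>i j. i < n \<Longrightarrow> j < n \<Longrightarrow> x i j \<in> bop"
  show "mat_norm n (\<lambda>i j. P (x i j)) \<le> c * mat_norm n x"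
  proof (rule le_mult_of_unit_ball_bound[OF mat_norm_nonneg])
    fix r :: real
    assume "0 < r" "r * mat_norm n x \<le> 1"
    then have "mat_norm n (\<lambda>i j. P (r *\<^sub>R x i j)) \<le> c"
      using x by (intro le) (simp_all add: mat_norm_scaleR bop_scaleR)
    also have "mat_norm n (\<lambda>i j. P (r *\<^sub>R x i j)) = mat_norm n (\<lambda>i j. r *\<^sub>R P (x i j))"
      using x by (intro mat_norm_cong projection_scaleR[OF assms(1)])
    finally show "r * mat_norm n (\<lambda>i j. P (x i j)) \<le> c"
      using \<open>0 < r\<close> by (simp add: mat_norm_scaleR)
  qed
qed

lemma amp_norm_leI:
  assumes "0 \<le> c"
    and "\<And>x. (\<And>i j. i < n \<Longrightarrow> j < n \<Longrightarrow> x i j \<in> bop) \<Longrightarrow> mat_norm n (\<lambda>i j. P (x i j)) \<le> c * mat_norm n x"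
  shows "amp_norm n P \<le> ereal c"
  unfolding amp_norm_def
proof (rule SUP_least, simp)
  fix x :: "nat \<Rightarrow> nat \<Rightarrow> 'a \<Rightarrow>\<^sub>L 'a"
  assume "(\<forall>i<n. \<forall>j<n. x i j \<in> bop) \<and> mat_norm n x \<le> 1"
  then show "mat_norm n (\<lambda>i j. P (x i j)) \<le> c"
    using assms(2)[of x] mult_left_le[of "mat_norm n x" c] \<open>0 \<le> c\<close> by fastforce
qed

text \<open>Padding a matrix with zeros preserves its norm, and \<open>P\<close> commutes with
  padding because \<open>P 0 = 0\<close>. So a bound at one level serves all lower levels, in
  particular the norm of \<open>P\<close> itself at level 1.\<close>

lemma amp_norm_mono:
  assumes "projection_onto S P" "m \<le> n"
  shows "amp_norm m P \<le> amp_norm n P"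
  unfolding amp_norm_def[of m]
proof (rule SUP_least, clarify)
  fix x :: "nat \<Rightarrow> nat \<Rightarrow> 'a \<Rightarrow>\<^sub>L 'a"
  assume x: "\<forall>i<m. \<forall>j<m. x i j \<in> bop" "mat_norm m x \<le> 1"
  define pad where "pad z = (\<lambda>i j. if i < m \<and> j < m then z i j else 0)"
    for z :: "nat \<Rightarrow> nat \<Rightarrow> 'a \<Rightarrow>\<^sub>L 'a"
  have cut: "(\<Sum>j<n. if j < m then f j else 0) = (\<Sum>j<m. f j)" for f :: "nat \<Rightarrow> 'b::comm_monoid_add"
    using \<open>m \<le> n\<close> by (subst sum.inter_filter[symmetric]) (auto intro!: sum.cong)
  have mv: "matvec n (pad z) \<xi> = (\<lambda>i. if i < m then matvec m z \<xi> i else 0)" for z \<xi>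
    by (auto simp: matvec_def pad_def fun_eq_iff cut[symmetric] intro!: sum.cong)
  have l2: "l2n n (\<lambda>i. if i < m then \<xi> i else 0) = l2n m \<xi>" for \<xi> :: "nat \<Rightarrow> 'a"
    by (simp add: l2n_def L2_set_def cut[symmetric] if_distrib[of "\<lambda>v. (norm v)\<^sup>2"] cong: if_cong)
  have l2le: "l2n m \<xi> \<le> l2n n \<xi>" for \<xi> :: "nat \<Rightarrow> 'a"
    unfolding l2n_def L2_set_def using \<open>m \<le> n\<close> by (intro real_sqrt_le_mono sum_mono2) auto
  have pad_norm: "mat_norm n (pad z) = mat_norm m z" for z
  proof (rule antisym; rule mat_norm_le[OF _ mat_norm_nonneg])
    show "l2n n (matvec n (pad z) \<xi>) \<le> mat_norm m z * l2n n \<xi>" for \<xi>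
      unfolding mv l2
      using l2n_matvec_le[of m z \<xi>] mult_left_mono[OF l2le[of \<xi>] mat_norm_nonneg[of m z]] by linarith
    show "l2n m (matvec m z \<xi>) \<le> mat_norm n (pad z) * l2n m \<xi>" for \<xi>
    proof -
      have "matvec m z (\<lambda>i. if i < m then \<xi> i else 0) = matvec m z \<xi>"
        by (simp add: matvec_def fun_eq_iff)
      then show ?thesis
        using l2n_matvec_le[of n "pad z" "\<lambda>i. if i < m then \<xi> i else 0"] by (simp add: mv l2)
    qed
  qed
  have "(\<lambda>i j. P (pad x i j)) = pad (\<lambda>i j. P (x i j))"
    by (simp add: pad_def fun_eq_iff projection_zero[OF assms(1)])
  then have "ereal (mat_norm m (\<lambda>i j. P (x i j))) = ereal (mat_norm n (\<lambda>i j. P (pad x i j)))"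
    by (simp add: pad_norm)
  also have "\<dots> \<le> amp_norm n P"
    unfolding amp_norm_def
    by (rule SUP_upper) (use x pad_norm[of x] in \<open>auto simp: pad_def\<close>)
  finally show "ereal (mat_norm m (\<lambda>i j. P (x i j))) \<le> amp_norm n P" .
qed


section \<open>Orthonormal frames of isometries\<close>

text \<open>The condition says \<open>J i^* J j = \<delta>_ij\<close>: isometries with mutually
  orthogonal ranges, which need not fill the target. Complex linearity is required at all indices so
  that the rules for adjoints need no index bound.\<close>

definition frame :: "nat \<Rightarrow> (nat \<Rightarrow> 'a::complex_hilbert \<Rightarrow>\<^sub>L 'b::complex_hilbert) \<Rightarrow> bool" where
  "frame n J \<longleftrightarrow> (\<forall>i. clin (J i)) \<and>
     (\<forall>i<n. \<forall>j<n. \<forall>x y. cinner (J i x) (J j y) = (if i = j then cinner x y else 0))"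

text \<open>A matrix over the small space becomes an operator on the large one. The left and right
  frames may differ because the averaging uses two independent unitaries.\<close>

definition assemble where
  "assemble n J J' x = (\<Sum>k<n. \<Sum>l<n. J k o\<^sub>L x k l o\<^sub>L adj (J' l))"

lemma frame_clin: "frame n J \<Longrightarrow> clin (J i)"
  by (simp add: frame_def)

lemma clin_assemble:
  assumes "frame n J" "frame n J'" "\<And>k l. k < n \<Longrightarrow> l < n \<Longrightarrow> x k l \<in> bop"
  shows "assemble n J J' x \<in> bop"
  using assms unfolding assemble_def bop_eq_clin
  by (auto intro!: clin_sum clin_compose clin_adj simp: frame_clin)

lemma bop_compress:
  assumes "clin J" "clin J'" "y \<in> bop"
  shows "adj J o\<^sub>L y o\<^sub>L J' \<in> bop"
  using assms by (auto intro!: clin_compose clin_adj simp: bop_eq_clin)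

lemma assemble_apply: "assemble n J J' x \<zeta> = (\<Sum>k<n. J k (matvec n x (\<lambda>l. adj (J' l) \<zeta>) k))"
  by (simp add: assemble_def matvec_def blinfun.sum_left blinfun.sum_right)

lemma cinner_frame_sums:
  assumes "frame n J"
  shows "cinner (\<Sum>i<n. J i (\<xi> i)) (\<Sum>i<n. J i (\<eta> i)) = (\<Sum>i<n. cinner (\<xi> i) (\<eta> i))"
proof -
  have "cinner (\<Sum>i<n. J i (\<xi> i)) (\<Sum>j<n. J j (\<eta> j))
      = (\<Sum>i<n. \<Sum>j<n. if i = j then cinner (\<xi> i) (\<eta> j) else 0)"
    using assms by (simp add: cinner_sum_left cinner_sum_right frame_def)
  then show ?thesis
    by simp
qed

lemma norm_frame_sum:
  assumes "frame n J"
  shows "norm (\<Sum>i<n. J i (\<xi> i)) = l2n n \<xi>"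
proof -
  have "complex_of_real ((norm (\<Sum>i<n. J i (\<xi> i)))\<^sup>2) = of_real ((l2n n \<xi>)\<^sup>2)"
    unfolding cinner_self[symmetric] cinner_frame_sums[OF assms] l2n_power2 by (simp add: cinner_self)
  then show ?thesis
    by (simp only: of_real_eq_iff) simp
qed

text \<open>Bessel's inequality: pairing \<open>\<zeta>\<close> with its own projection to the sum
  of the ranges gives the squared norm of the coefficients, and Cauchy-Schwarz finishes.\<close>

lemma frame_bessel:
  assumes "frame n J"
  shows "l2n n (\<lambda>i. adj (J i) \<zeta>) \<le> norm \<zeta>"
proof -
  let ?\<xi> = "\<lambda>i. adj (J i) \<zeta>"
  have "cinner \<zeta> (\<Sum>i<n. J i (?\<xi> i)) = of_real ((l2n n ?\<xi>)\<^sup>2)"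
    using assms
    by (simp add: cinner_sum_right cinner_adj_left[symmetric] frame_clin cinner_self l2n_power2)
  then have "(l2n n ?\<xi>)\<^sup>2 \<le> norm \<zeta> * l2n n ?\<xi>"
    using cmod_cinner_le[of \<zeta> "\<Sum>i<n. J i (?\<xi> i)"]
    by (simp add: norm_frame_sum[OF assms] del: of_real_power)
  then show ?thesis
    by (cases "l2n n ?\<xi> = 0") (simp_all add: power2_eq_square less_le)
qed

text \<open>The operator factors as a contraction into the direct sum (Bessel), then the matrix,
  then an isometry.\<close>

lemma norm_assemble_le:
  assumes "frame n J" "frame n J'"
  shows "norm (assemble n J J' x) \<le> mat_norm n x"
proof (rule norm_blinfun_bound[OF mat_norm_nonneg])
  fix \<zeta>
  have "norm (assemble n J J' x \<zeta>) \<le> mat_norm n x * l2n n (\<lambda>l. adj (J' l) \<zeta>)"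
    by (simp add: assemble_apply norm_frame_sum[OF assms(1)] l2n_matvec_le)
  also have "\<dots> \<le> mat_norm n x * norm \<zeta>"
    by (intro mult_left_mono frame_bessel assms mat_norm_nonneg)
  finally show "norm (assemble n J J' x \<zeta>) \<le> mat_norm n x * norm \<zeta>" .
qed

text \<open>The form of the matrix of corners at \<open>\<xi>\<close>, \<open>\<eta>\<close> is the
  form of \<open>y\<close> at the frame sums of \<open>\<xi>\<close> and \<open>\<eta>\<close>,
  which have the same norms.\<close>

lemma mat_norm_compress_le:
  assumes "frame n J" "frame n J'"
  shows "mat_norm n (\<lambda>k l. adj (J k) o\<^sub>L y o\<^sub>L J' l) \<le> norm y"
proof (rule mat_norm_le_form[OF _ norm_ge_zero])
  fix \<xi> \<eta>
  have "(\<Sum>k<n. cinner (matvec n (\<lambda>k l. adj (J k) o\<^sub>L y o\<^sub>L J' l) \<xi> k) (\<eta> k))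
      = cinner (y (\<Sum>l<n. J' l (\<xi> l))) (\<Sum>k<n. J k (\<eta> k))"
    using assms
    by (simp add: matvec_def cinner_sum_left cinner_sum_right blinfun.sum_right cinner_adj_left frame_clin)
  moreover have "cmod (cinner (y (\<Sum>l<n. J' l (\<xi> l))) (\<Sum>k<n. J k (\<eta> k)))
      \<le> norm y * l2n n \<xi> * l2n n \<eta>"
    using assms
    by (intro order_trans[OF cmod_cinner_le])
      (metis norm_frame_sum mult_right_mono norm_blinfun l2n_nonneg)
  ultimately show "cmod (\<Sum>k<n. cinner (matvec n (\<lambda>k l. adj (J k) o\<^sub>L y o\<^sub>L J' l) \<xi> k) (\<eta> k))
      \<le> norm y * l2n n \<xi> * l2n n \<eta>"
    by simp
qed

lemma norm_amplification_le:
  assumes J: "frame n J" and P: "projection_onto S P" "amp_norm n P \<le> ereal c" and "y \<in> bop"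
  shows "norm (assemble n J J (\<lambda>k l. P (adj (J k) o\<^sub>L y o\<^sub>L J l))) \<le> c * norm y"
proof -
  have "norm (assemble n J J (\<lambda>k l. P (adj (J k) o\<^sub>L y o\<^sub>L J l)))
      \<le> mat_norm n (\<lambda>k l. P (adj (J k) o\<^sub>L y o\<^sub>L J l))"
    by (rule norm_assemble_le[OF J J])
  also have "\<dots> \<le> c * mat_norm n (\<lambda>k l. adj (J k) o\<^sub>L y o\<^sub>L J l)"
    using J \<open>y \<in> bop\<close> by (intro amp_norm_leD(2)[OF P] bop_compress) (auto simp: frame_clin)
  also have "\<dots> \<le> c * norm y"
    by (intro mult_left_mono mat_norm_compress_le J amp_norm_leD(1)[OF P])
  finally show ?thesis .
qed

lemma adj_frame_compose:
  assumes "frame n J" "i < n" "j < n"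
  shows "adj (J i) o\<^sub>L J j = (if i = j then id_blinfun else 0)"
proof (rule blinfun_eqI, rule cinner_ext)
  fix x y
  show "cinner ((adj (J i) o\<^sub>L J j) x) y = cinner ((if i = j then id_blinfun else 0) x) y"
    using assms by (auto simp: cinner_adj_left frame_clin) (auto simp: frame_def)
qed

lemma adj_scaleC:
  assumes "clin A"
  shows "adj (c *\<^sub>C A) = cnj c *\<^sub>C adj A"
proof (rule blinfun_eqI, rule cinner_ext)
  fix x y
  show "cinner (adj (c *\<^sub>C A) x) y = cinner ((cnj c *\<^sub>C adj A) x) y"
    using assms
    by (simp add: cinner_adj_left clin_scaleC cinner_scaleC_left cinner_scaleC_right)
qed

lemma compose_scaleC_left: "(c *\<^sub>C A) o\<^sub>L B = c *\<^sub>C (A o\<^sub>L B)"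
  by (rule blinfun_eqI) simp

lemma compose_scaleC_right: "clin A \<Longrightarrow> A o\<^sub>L (c *\<^sub>C B) = c *\<^sub>C (A o\<^sub>L B)"
  by (rule blinfun_eqI) (simp add: clin_def)

lemma compose_sum_left: "(\<Sum>i\<in>I. f i) o\<^sub>L B = (\<Sum>i\<in>I. f i o\<^sub>L B)"
  by (rule bounded_bilinear.sum_left[OF bounded_bilinear_blinfun_compose])

lemma compose_sum_right: "A o\<^sub>L (\<Sum>i\<in>I. f i) = (\<Sum>i\<in>I. A o\<^sub>L f i)"
  by (rule bounded_bilinear.sum_right[OF bounded_bilinear_blinfun_compose])

section \<open>Averaging over the Weyl unitaries\<close>

definition unity_root :: "nat \<Rightarrow> nat \<Rightarrow> complex" where
  "unity_root n k = cis (2 * pi * real k / real n)"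

text \<open>For distinct indices this is a full geometric sum of an n-th root of unity different
  from 1; for equal ones every term is 1.\<close>

lemma unity_root_orthogonality:
  assumes "k < n" "k' < n"
  shows "(\<Sum>t<n. unity_root n k' ^ t * cnj (unity_root n k ^ t)) = (if k = k' then of_nat n else 0)"
proof -
  let ?z = "unity_root n k' * cnj (unity_root n k)"
  have unit: "unity_root n j * cnj (unity_root n j) = 1" for j
    by (simp add: unity_root_def complex_norm_square[symmetric])
  have inj: "inj_on (unity_root n) {..<n}"
    using Complex.bij_betw_roots_unity[of n] assms unfolding unity_root_def[abs_def] bij_betw_def by auto
  have pow: "unity_root n j ^ n = 1" if "j < n" for j
    using Complex.bij_betw_roots_unity[of n] that unfolding unity_root_def[abs_def] bij_betw_def by auto
  have "(\<Sum>t<n. unity_root n k' ^ t * cnj (unity_root n k ^ t)) = (\<Sum>t<n. ?z ^ t)"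
    by (simp add: power_mult_distrib)
  also have "\<dots> = (if k = k' then of_nat n else 0)"
  proof (cases "k = k'")
    case True
    then show ?thesis
      by (simp add: unit)
  next
    case False
    have "unity_root n k' = ?z * unity_root n k"
      using unit[of k] by (simp add: mult.assoc mult.commute[of "cnj _"])
    then have "?z \<noteq> 1"
      using False assms inj by (metis inj_onD lessThan_iff mult_1)
    moreover have "?z ^ n = 1"
      using pow assms by (simp add: power_mult_distrib flip: complex_cnj_power)
    ultimately show ?thesis
      using False by (simp add: geometric_sum)
  qed
  finally show ?thesis .
qed

lemma bij_betw_shift_mod: "bij_betw (\<lambda>s. (k + s) mod n) {..<n} {..<n :: nat}"
proof -
  have le: "a = b" if "(k + a) mod n = (k + b) mod n" "a \<le> b" "b < n" for a b
  proof -
    have "n dvd b - a"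
      using that mod_eq_dvd_iff_nat[of "k + a" "k + b" n] by simp
    then show ?thesis
      using that by (metis diff_is_0_eq dvd_imp_le le_antisym less_imp_diff_less linorder_not_le not_gr_zero)
  qed
  have "inj_on (\<lambda>s. (k + s) mod n) {..<n}"
    by (rule inj_onI) (metis le lessThan_iff linorder_le_cases)
  moreover have "(\<lambda>s. (k + s) mod n) ` {..<n} \<subseteq> {..<n}"
    by auto
  ultimately show ?thesis
    by (simp add: bij_betw_def endo_inj_surj)
qed

lemma shift_mod_eq_iff:
  assumes "k < n" "l < n"
  shows "(k + s) mod n = (l + s) mod n \<longleftrightarrow> k = (l :: nat)"
  using inj_on_eq_iff[OF bij_betw_imp_inj_on[OF bij_betw_shift_mod[of s n]], of k l] assms
  by (simp add: add.commute[of s])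

text \<open>The frames obtained from \<open>J\<close> by the Weyl unitaries (a power of the diagonal of roots of unity
  followed by a cyclic shift). Averaging over them plays the role of averaging over the unitary
  group of \<open>M\<^sub>n\<close>.\<close>

definition weyl_frame where
  "weyl_frame n J s t k = (unity_root n k ^ t) *\<^sub>C J ((k + s) mod n)"

lemma frame_weyl_frame:
  assumes "frame n J"
  shows "frame n (weyl_frame n J s t)"
proof -
  have unit: "cnj (unity_root n k) ^ t * unity_root n k ^ t = 1" for k
  proof -
    have "cnj (unity_root n k) * unity_root n k = 1"
      using complex_norm_square[of "unity_root n k"] by (simp add: unity_root_def mult.commute)
    then show ?thesis
      by (metis power_mult_distrib power_one)
  qed
  have "cinner (weyl_frame n J s t i x) (weyl_frame n J s t j y) = (if i = j then cinner x y else 0)"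
    if "i < n" "j < n" for i j x y
  proof -
    have "(i + s) mod n < n" "(j + s) mod n < n"
      using that by auto
    then show ?thesis
      using assms that unit[of i]
      by (cases "i = j")
        (simp_all add: weyl_frame_def cinner_scaleC_left cinner_scaleC_right frame_def
          shift_mod_eq_iff flip: mult.assoc)
  qed
  then show ?thesis
    using assms by (simp add: frame_def weyl_frame_def clin_scaleC)
qed

lemma sum_scaleC_right: "(\<Sum>i\<in>I. c *\<^sub>C f i) = c *\<^sub>C (\<Sum>i\<in>I. f i :: 'a::complex_vector)"
  by (rule complex_vector.scale_sum_right[symmetric])

lemma sum_scaleC_left: "(\<Sum>i\<in>I. f i *\<^sub>C v) = (\<Sum>i\<in>I. f i) *\<^sub>C (v :: 'a::complex_vector)"
  by (rule complex_vector.scale_sum_left[symmetric])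

lemma sum_swap_pairs:
  "(\<Sum>a\<in>A. \<Sum>b\<in>B. \<Sum>c\<in>C. \<Sum>d\<in>D. f a b c d) = (\<Sum>c\<in>C. \<Sum>d\<in>D. \<Sum>a\<in>A. \<Sum>b\<in>B. f a b c d)"
proof -
  have "(\<Sum>a\<in>A. \<Sum>b\<in>B. \<Sum>c\<in>C. \<Sum>d\<in>D. f a b c d) = (\<Sum>a\<in>A. \<Sum>c\<in>C. \<Sum>b\<in>B. \<Sum>d\<in>D. f a b c d)"
    by (rule sum.cong[OF refl], rule sum.swap)
  also have "\<dots> = (\<Sum>c\<in>C. \<Sum>a\<in>A. \<Sum>b\<in>B. \<Sum>d\<in>D. f a b c d)"
    by (rule sum.swap)
  also have "\<dots> = (\<Sum>c\<in>C. \<Sum>a\<in>A. \<Sum>d\<in>D. \<Sum>b\<in>B. f a b c d)"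
    by (rule sum.cong[OF refl], rule sum.cong[OF refl], rule sum.swap)
  also have "\<dots> = (\<Sum>c\<in>C. \<Sum>d\<in>D. \<Sum>a\<in>A. \<Sum>b\<in>B. f a b c d)"
    by (rule sum.cong[OF refl], rule sum.swap)
  finally show ?thesis .
qed

lemma projection_linear_combination:
  assumes "projection_onto S Q" "\<And>i j. i \<in> I \<Longrightarrow> j \<in> I' \<Longrightarrow> f i j \<in> bop"
  shows "Q (\<Sum>i\<in>I. \<Sum>j\<in>I'. c i j *\<^sub>C f i j) = (\<Sum>i\<in>I. \<Sum>j\<in>I'. c i j *\<^sub>C Q (f i j))"
proof -
  have inner: "(\<Sum>j\<in>I'. c i j *\<^sub>C f i j) \<in> bop" if "i \<in> I" for i
    by (rule complex_vector.subspace_sum[OF csubspace_bop]) (use assms(2) that bop_scaleC in blast)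
  have "Q (\<Sum>i\<in>I. \<Sum>j\<in>I'. c i j *\<^sub>C f i j) = (\<Sum>i\<in>I. Q (\<Sum>j\<in>I'. c i j *\<^sub>C f i j))"
    by (rule projection_sum[OF assms(1) inner])
  also have "\<dots> = (\<Sum>i\<in>I. \<Sum>j\<in>I'. c i j *\<^sub>C Q (f i j))"
  proof (rule sum.cong[OF refl])
    fix i
    assume "i \<in> I"
    then have "Q (\<Sum>j\<in>I'. c i j *\<^sub>C f i j) = (\<Sum>j\<in>I'. Q (c i j *\<^sub>C f i j))"
      by (intro projection_sum[OF assms(1)] bop_scaleC assms(2))
    also have "\<dots> = (\<Sum>j\<in>I'. c i j *\<^sub>C Q (f i j))"
      by (rule sum.cong[OF refl]) (rule projection_scaleC[OF assms(1) assms(2)[OF \<open>i \<in> I\<close>]])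
    finally show "Q (\<Sum>j\<in>I'. c i j *\<^sub>C f i j) = (\<Sum>j\<in>I'. c i j *\<^sub>C Q (f i j))" .
  qed
  finally show ?thesis .
qed

lemma sum_scaleC_delta:
  fixes f :: "nat \<Rightarrow> nat \<Rightarrow> 'a::complex_vector"
  assumes "k < n" "l < n"
  shows "(\<Sum>k'<n. \<Sum>l'<n. ((if k' = k then c else 0) * (if l' = l then c else 0)) *\<^sub>C f k' l')
    = (c * c) *\<^sub>C f k l"
proof -
  have "(\<Sum>l'<n. ((if k' = k then c else 0) * (if l' = l then c else 0)) *\<^sub>C f k' l')
      = (if k' = k then (c * c) *\<^sub>C f k' l else 0)" for k'
  proof -
    have "(\<Sum>l'<n. ((if k' = k then c else 0) * (if l' = l then c else 0)) *\<^sub>C f k' l')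
        = (\<Sum>l'<n. if l' = l then (if k' = k then (c * c) *\<^sub>C f k' l' else 0) else 0)"
      by (rule sum.cong[OF refl]) simp
    then show ?thesis
      using \<open>l < n\<close> by simp
  qed
  then show ?thesis
    using \<open>k < n\<close> by simp
qed

text \<open>Expanding the assembled operator yields one term for each entry \<open>x k' l'\<close>.
  The phases on the left and on the right vary independently, so the sums over \<open>t\<close> and
  \<open>t'\<close> are character sums: they cancel all terms except \<open>k' = k\<close>,
  \<open>l' = l\<close> and leave a factor n each.\<close>

lemma weyl_average:
  fixes J :: "nat \<Rightarrow> 'a::complex_hilbert \<Rightarrow>\<^sub>L 'b::complex_hilbert" and S :: "('b \<Rightarrow>\<^sub>L 'b) set"
  assumes J: "frame n J" and Q: "projection_onto S Q" and "S \<subseteq> bop"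
    and x: "\<And>k l. k < n \<Longrightarrow> l < n \<Longrightarrow> x k l \<in> bop" and "k < n" "l < n"
  shows "(\<Sum>s<n. \<Sum>s'<n. \<Sum>t<n. \<Sum>t'<n. adj (weyl_frame n J s t k) o\<^sub>L
      Q (assemble n (weyl_frame n J s t) (weyl_frame n J s' t') x) o\<^sub>L weyl_frame n J s' t' l)
    = (real n)\<^sup>2 *\<^sub>R (\<Sum>p<n. \<Sum>q<n. adj (J p) o\<^sub>L Q (J p o\<^sub>L x k l o\<^sub>L adj (J q)) o\<^sub>L J q)"
proof -
  let ?r = "unity_root n"
  define B where "B s s' k' l' = adj (J ((k + s) mod n)) o\<^sub>L
    Q (J ((k' + s) mod n) o\<^sub>L x k' l' o\<^sub>L adj (J ((l' + s') mod n))) o\<^sub>L J ((l + s') mod n)"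
    for s s' k' l'
  define C where "C p q = adj (J p) o\<^sub>L Q (J p o\<^sub>L x k l o\<^sub>L adj (J q)) o\<^sub>L J q" for p q
  have inb: "J p o\<^sub>L x k' l' o\<^sub>L adj (J q) \<in> bop" if "k' < n" "l' < n" for p q k' l'
    using x[OF that] J by (auto simp: bop_eq_clin frame_clin intro!: clin_compose clin_adj)
  have weyl_term: "adj (weyl_frame n J s t k) o\<^sub>L
      Q (assemble n (weyl_frame n J s t) (weyl_frame n J s' t') x) o\<^sub>L weyl_frame n J s' t' l
    = (\<Sum>k'<n. \<Sum>l'<n. ((?r k' ^ t * cnj (?r k ^ t)) * (?r l ^ t' * cnj (?r l' ^ t'))) *\<^sub>C B s s' k' l')"
    for s s' t t'
  proof -
    have "assemble n (weyl_frame n J s t) (weyl_frame n J s' t') x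
        = (\<Sum>k'<n. \<Sum>l'<n. (?r k' ^ t * cnj (?r l' ^ t')) *\<^sub>C
            (J ((k' + s) mod n) o\<^sub>L x k' l' o\<^sub>L adj (J ((l' + s') mod n))))"
      unfolding assemble_def weyl_frame_def
      using x by (intro sum.cong refl)
        (simp add: adj_scaleC frame_clin[OF J] compose_scaleC_left compose_scaleC_right clin_compose
          scaleC_scaleC bop_eq_clin)
    then have Qa: "Q (assemble n (weyl_frame n J s t) (weyl_frame n J s' t') x)
        = (\<Sum>k'<n. \<Sum>l'<n. (?r k' ^ t * cnj (?r l' ^ t')) *\<^sub>C
            Q (J ((k' + s) mod n) o\<^sub>L x k' l' o\<^sub>L adj (J ((l' + s') mod n))))"
      using projection_linear_combination[OF Q, of "{..<n}" "{..<n}"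
          "\<lambda>k' l'. J ((k' + s) mod n) o\<^sub>L x k' l' o\<^sub>L adj (J ((l' + s') mod n))"] inb
      by (simp only: lessThan_iff)
    have "clin (Q (J p o\<^sub>L x k' l' o\<^sub>L adj (J q)))" if "k' < n" "l' < n" for p q k' l'
      using projection_in[OF Q inb[OF that]] \<open>S \<subseteq> bop\<close> by (auto simp: bop_eq_clin)
    then show ?thesis
      unfolding Qa weyl_frame_def compose_sum_left compose_sum_right
      by (intro sum.cong refl)
        (simp add: adj_scaleC frame_clin[OF J] compose_scaleC_left compose_scaleC_right clin_adj
          clin_compose scaleC_scaleC B_def mult_ac)
  qed
  have "(\<Sum>t<n. \<Sum>t'<n. adj (weyl_frame n J s t k) o\<^sub>L
      Q (assemble n (weyl_frame n J s t) (weyl_frame n J s' t') x) o\<^sub>L weyl_frame n J s' t' l)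
    = (real n)\<^sup>2 *\<^sub>R B s s' k l" for s s'
  proof -
    have "(\<Sum>t<n. \<Sum>t'<n. \<Sum>k'<n. \<Sum>l'<n.
          ((?r k' ^ t * cnj (?r k ^ t)) * (?r l ^ t' * cnj (?r l' ^ t'))) *\<^sub>C B s s' k' l')
        = (\<Sum>k'<n. \<Sum>l'<n. \<Sum>t<n. \<Sum>t'<n.
          ((?r k' ^ t * cnj (?r k ^ t)) * (?r l ^ t' * cnj (?r l' ^ t'))) *\<^sub>C B s s' k' l')"
      by (rule sum_swap_pairs)
    also have "\<dots> = (\<Sum>k'<n. \<Sum>l'<n. ((\<Sum>t<n. ?r k' ^ t * cnj (?r k ^ t)) *
          (\<Sum>t'<n. ?r l ^ t' * cnj (?r l' ^ t'))) *\<^sub>C B s s' k' l')"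
      by (simp only: sum_scaleC_left sum_product)
    also have "\<dots> = (\<Sum>k'<n. \<Sum>l'<n. ((if k' = k then of_nat n else 0) *
          (if l' = l then of_nat n else 0)) *\<^sub>C B s s' k' l')"
    proof (rule sum.cong[OF refl], rule sum.cong[OF refl])
      fix k' l'
      assume "k' \<in> {..<n}" "l' \<in> {..<n}"
      then show "((\<Sum>t<n. ?r k' ^ t * cnj (?r k ^ t)) * (\<Sum>t'<n. ?r l ^ t' * cnj (?r l' ^ t'))) *\<^sub>C
          B s s' k' l'
        = ((if k' = k then of_nat n else 0) * (if l' = l then of_nat n else 0)) *\<^sub>C B s s' k' l'"
        using unity_root_orthogonality[of k n k'] unity_root_orthogonality[of l' n l] \<open>k < n\<close> \<open>l < n\<close>
        by (simp only: lessThan_iff) (simp only: eq_commute[of k k'])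
    qed
    also have "\<dots> = (of_nat n * of_nat n) *\<^sub>C B s s' k l"
      using \<open>k < n\<close> \<open>l < n\<close> by (rule sum_scaleC_delta)
    also have "\<dots> = (real n)\<^sup>2 *\<^sub>R B s s' k l"
    proof -
      have "complex_of_nat n * complex_of_nat n = of_real ((real n)\<^sup>2)"
        by (simp add: power2_eq_square)
      then show ?thesis
        by (simp only: scaleC_of_real)
    qed
    finally show ?thesis
      by (simp only: weyl_term)
  qed
  then have avg: "(\<Sum>s<n. \<Sum>s'<n. \<Sum>t<n. \<Sum>t'<n. adj (weyl_frame n J s t k) o\<^sub>L
      Q (assemble n (weyl_frame n J s t) (weyl_frame n J s' t') x) o\<^sub>L weyl_frame n J s' t' l)
    = (real n)\<^sup>2 *\<^sub>R (\<Sum>s<n. \<Sum>s'<n. B s s' k l)"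
    by (simp only: scaleR_sum_right)
  \<comment> \<open>The shifts enter here: whatever \<open>k\<close> and \<open>l\<close> are, the
    shifted indices run once through all pairs \<open>(p, q)\<close>. Hence the same map acts on
    every entry.\<close>
  have "(\<Sum>s<n. \<Sum>s'<n. B s s' k l) = (\<Sum>s<n. \<Sum>s'<n. C ((k + s) mod n) ((l + s') mod n))"
    by (simp only: B_def C_def)
  also have "\<dots> = (\<Sum>p<n. \<Sum>s'<n. C p ((l + s') mod n))"
    by (rule sum.reindex_bij_betw[OF bij_betw_shift_mod, of "\<lambda>p. \<Sum>s'<n. C p ((l + s') mod n)"])
  also have "\<dots> = (\<Sum>p<n. \<Sum>q<n. C p q)"
    by (rule sum.cong[OF refl]) (rule sum.reindex_bij_betw[OF bij_betw_shift_mod, of "C p" for p])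
  finally have "(\<Sum>s<n. \<Sum>s'<n. B s s' k l) = (\<Sum>p<n. \<Sum>q<n. C p q)" .
  then show ?thesis
    by (simp only: avg C_def)
qed

text \<open>Of the range \<open>M\<close> only this matters: its corners lie in \<open>S\<close>,
  and corner copies of \<open>S\<close> lie in it. This covers the matrix spaces and both tensor
  products, although in the latter the ranges of the \<open>J i\<close> are far from spanning.
  Taking the mean of all corners of \<open>Q\<close>, rather than one, makes the amplification an
  average of maps of norm at most \<open>c\<close>.\<close>

lemma lambda_n_le_lambda_frame:
  fixes J :: "nat \<Rightarrow> 'h::complex_hilbert \<Rightarrow>\<^sub>L 't::complex_hilbert"
  assumes "1 \<le> n" "csubspace S" "S \<subseteq> bop" and J: "frame n J"
    and "M \<subseteq> bop"
    and compress: "\<And>y i j. y \<in> M \<Longrightarrow> i < n \<Longrightarrow> j < n \<Longrightarrow> adj (J i) o\<^sub>L y o\<^sub>L J j \<in> S"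
    and embed: "\<And>x i j. x \<in> S \<Longrightarrow> i < n \<Longrightarrow> j < n \<Longrightarrow> J i o\<^sub>L x o\<^sub>L adj (J j) \<in> M"
  shows "lambda_n n S \<le> lambda M"
  unfolding lambda_def
proof (rule Inf_greatest, clarify)
  fix c Q
  assume Q: "projection_onto M Q" "map_norm Q \<le> ereal c"
  have n0: "real n \<noteq> 0"
    using \<open>1 \<le> n\<close> by simp
  note c = map_norm_leD[OF Q]
  define P where "P a = inverse ((real n)\<^sup>2) *\<^sub>R
    (\<Sum>p<n. \<Sum>q<n. adj (J p) o\<^sub>L Q (J p o\<^sub>L a o\<^sub>L adj (J q)) o\<^sub>L J q)" for a
  have inb: "J p o\<^sub>L a o\<^sub>L adj (J q) \<in> bop" if "a \<in> bop" for a p q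
    using that J by (auto simp: bop_eq_clin frame_clin intro!: clin_compose clin_adj)
  have "projection_onto S P"
    unfolding projection_onto_def
  proof (intro conjI ballI allI subsetI)
    show "P (T + R) = P T + P R" if "T \<in> bop" "R \<in> bop" for T R
      using projection_add[OF Q(1) inb[OF that(1)] inb[OF that(2)]]
      by (simp add: P_def bounded_bilinear.add_left[OF bounded_bilinear_blinfun_compose]
          bounded_bilinear.add_right[OF bounded_bilinear_blinfun_compose] sum.distrib
          scaleR_add_right)
    show "P (a *\<^sub>C T) = a *\<^sub>C P T" if "T \<in> bop" for a T
      using projection_scaleC[OF Q(1) inb[OF that]]
      by (simp add: P_def compose_scaleC_left compose_scaleC_right frame_clin[OF J] clin_adj
          sum_scaleC_right scaleC_of_real[symmetric] scaleC_scaleC mult.commute)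
    show "R \<in> S" if "R \<in> P ` bop" for R
      using that compress projection_in[OF Q(1) inb]
      by (auto simp: P_def scaleC_of_real[symmetric] intro!: complex_vector.subspace_scale[OF assms(2)]
          complex_vector.subspace_sum[OF assms(2)])
    \<comment> \<open>\<open>Q\<close> fixes the corner copy of \<open>T\<close> because that copy
      lies in \<open>M\<close>, and the isometries then cancel. Each of the n^2 corners returns
      \<open>T\<close>.\<close>
    show "P T = T" if "T \<in> S" for T
    proof -
      have "adj (J p) o\<^sub>L Q (J p o\<^sub>L T o\<^sub>L adj (J q)) o\<^sub>L J q = T" if "p < n" "q < n" for p q
      proof -
        have "adj (J p) o\<^sub>L Q (J p o\<^sub>L T o\<^sub>L adj (J q)) o\<^sub>L J q
            = (adj (J p) o\<^sub>L J p) o\<^sub>L T o\<^sub>L (adj (J q) o\<^sub>L J q)"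
          using projection_fixes[OF Q(1) embed[OF \<open>T \<in> S\<close> that]] by (simp add: blinfun_eqI)
        then show ?thesis
          by (simp add: adj_frame_compose[OF J] that blinfun_eqI)
      qed
      moreover have "inverse ((real n)\<^sup>2) * (real n * real n) = 1"
        using n0 by (simp add: power2_eq_square[symmetric])
      ultimately show ?thesis
        by (simp add: P_def sum_constant_scaleR)
    qed
  qed
  moreover have "amp_norm n P \<le> ereal c"
  proof (rule amp_norm_leI[OF c(1)])
    fix x :: "nat \<Rightarrow> nat \<Rightarrow> 'h \<Rightarrow>\<^sub>L 'h"
    assume x: "\<And>i j. i < n \<Longrightarrow> j < n \<Longrightarrow> x i j \<in> bop"
    let ?W = "weyl_frame n J"
    define Y where "Y s s' t t' = (\<lambda>k l. adj (?W s t k) o\<^sub>L Q (assemble n (?W s t) (?W s' t') x) o\<^sub>L ?W s' t' l)"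
      for s s' t t'
    have Y: "mat_norm n (Y s s' t t') \<le> c * mat_norm n x" for s s' t t'
    proof -
      have "mat_norm n (Y s s' t t') \<le> norm (Q (assemble n (?W s t) (?W s' t') x))"
        unfolding Y_def by (intro mat_norm_compress_le frame_weyl_frame J)
      also have "\<dots> \<le> c * norm (assemble n (?W s t) (?W s' t') x)"
        using x by (intro c(2) clin_assemble frame_weyl_frame J)
      also have "\<dots> \<le> c * mat_norm n x"
        by (intro mult_left_mono norm_assemble_le frame_weyl_frame J c(1))
      finally show ?thesis .
    qed
    \<comment> \<open>There are n^4 quadruples \<open>(s, s', t, t')\<close>. Since \<open>P\<close>
      carries the factor n^-2 and the average the factor n^2, multiplying by n^4 turns the entries
      of the amplification into the plain sum of the matrices \<open>Y\<close>.\<close>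
    have "real n ^ 4 * mat_norm n (\<lambda>k l. P (x k l)) = mat_norm n (\<lambda>k l. real n ^ 4 *\<^sub>R P (x k l))"
      by (simp add: mat_norm_scaleR)
    also have "\<dots> = mat_norm n (\<lambda>k l. \<Sum>s<n. \<Sum>s'<n. \<Sum>t<n. \<Sum>t'<n. Y s s' t t' k l)"
    proof (rule mat_norm_cong)
      fix k l
      assume kl: "k < n" "l < n"
      have "real n ^ 4 *\<^sub>R P (x k l) = (real n)\<^sup>2 *\<^sub>R
          (\<Sum>p<n. \<Sum>q<n. adj (J p) o\<^sub>L Q (J p o\<^sub>L x k l o\<^sub>L adj (J q)) o\<^sub>L J q)"
      proof -
        have "real n ^ 4 * inverse ((real n)\<^sup>2) = (real n)\<^sup>2"
          using n0 by (simp add: power2_eq_square power4_eq_xxxx field_simps)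
        then show ?thesis
          by (simp only: P_def scaleR_scaleR)
      qed
      then show "real n ^ 4 *\<^sub>R P (x k l) = (\<Sum>s<n. \<Sum>s'<n. \<Sum>t<n. \<Sum>t'<n. Y s s' t t' k l)"
        unfolding Y_def by (simp only: weyl_average[OF J Q(1) \<open>M \<subseteq> bop\<close> x kl])
    qed
    also have "\<dots> \<le> (\<Sum>s<n. \<Sum>s'<n. \<Sum>t<n. \<Sum>t'<n. c * mat_norm n x)"
      by (intro order_trans[OF mat_norm_sum_le] sum_mono Y)
    also have "\<dots> = real n ^ 4 * (c * mat_norm n x)"
      by (simp add: power4_eq_xxxx mult_ac)
    finally show "mat_norm n (\<lambda>k l. P (x k l)) \<le> c * mat_norm n x"
      using \<open>1 \<le> n\<close> by simp
  qed
  ultimately show "lambda_n n S \<le> ereal c"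
    unfolding lambda_n_def by (intro Inf_lower) blast
qed


section \<open>Weak operator limits\<close>

text \<open>Tychonoff's theorem; refining the filter replaces passing to an ultrafilter.\<close>

lemma pointwise_limit_along_finer_filter:
  fixes f :: "'i \<Rightarrow> 'x \<Rightarrow> complex"
  assumes "F \<noteq> bot" and bound: "\<And>i x. cmod (f i x) \<le> b x"
  obtains G l where "G \<le> F" "G \<noteq> bot" "\<And>x. ((\<lambda>i. f i x) \<longlongrightarrow> l x) G"
proof -
  define K where "K = PiE UNIV (\<lambda>x. cball (0::complex) (b x))"
  have "compactin (product_topology (\<lambda>_. euclidean) UNIV) K"
    unfolding K_def compactin_PiE by simp
  then have "compact K"
    by (simp add: euclidean_product_topology)
  moreover have "eventually (\<lambda>g. g \<in> K) (filtermap f F)"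
    using bound by (auto simp: eventually_filtermap K_def intro!: always_eventually)
  moreover have "filtermap f F \<noteq> bot"
    using \<open>F \<noteq> bot\<close> by (simp add: filtermap_bot_iff)
  ultimately obtain l where l: "inf (nhds l) (filtermap f F) \<noteq> bot"
    unfolding compact_filter by blast
  \<comment> \<open>Refining by preimages of neighbourhoods of the cluster point \<open>l\<close>
    forces convergence to \<open>l\<close>; the refined filter is proper exactly because
    \<open>l\<close> is a cluster point.\<close>
  define G where "G = inf (filtercomap f (nhds l)) F"
  have "G \<noteq> bot"
  proof
    assume "G = bot"
    then obtain P Q where "eventually P (filtercomap f (nhds l))" "eventually Q F"
        and PQ: "\<And>i. P i \<Longrightarrow> Q i \<Longrightarrow> False"
      by (auto simp: G_def eventually_inf trivial_limit_def)
    then obtain R where R: "eventually R (nhds l)" "\<And>i. R (f i) \<Longrightarrow> P i"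
      by (auto simp: eventually_filtercomap)
    have "eventually (\<lambda>g. \<exists>i. Q i \<and> g = f i) (filtermap f F)"
      using \<open>eventually Q F\<close> by (auto simp: eventually_filtermap elim: eventually_mono)
    then have "eventually (\<lambda>_. False) (inf (nhds l) (filtermap f F))"
      unfolding eventually_inf
      by (rule_tac exI[of _ R], rule_tac exI[of _ "\<lambda>g. \<exists>i. Q i \<and> g = f i"]) (use R PQ in auto)
    with l show False
      by (simp add: trivial_limit_def)
  qed
  moreover have "(f \<longlongrightarrow> l) G"
    unfolding G_def by (rule filterlim_mono[OF filterlim_filtercomap order_refl inf_le1])
  then have "((\<lambda>i. f i x) \<longlongrightarrow> l x) G" for x
    by (rule continuous_on_tendsto_compose[OF continuous_on_product_coordinates]) auto
  ultimately show ?thesis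
    using that[of G l] by (simp add: G_def)
qed

definition wot_limit ::
    "('i \<Rightarrow> 'h::complex_hilbert \<Rightarrow>\<^sub>L 'h) \<Rightarrow> ('h \<Rightarrow>\<^sub>L 'h) \<Rightarrow> 'i filter \<Rightarrow> bool" where
  "wot_limit T L G \<longleftrightarrow> (\<forall>\<xi> \<eta>. ((\<lambda>i. cinner (T i \<xi>) \<eta>) \<longlongrightarrow> cinner (L \<xi>) \<eta>) G)"

lemma wot_limitD: "wot_limit T L G \<Longrightarrow> ((\<lambda>i. cinner (T i \<xi>) \<eta>) \<longlongrightarrow> cinner (L \<xi>) \<eta>) G"
  by (simp add: wot_limit_def)

lemma wot_limit_unique:
  assumes "wot_limit T L G" "wot_limit T L' G" "G \<noteq> bot"
  shows "L = L'"
proof (rule blinfun_eqI, rule cinner_ext)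
  show "cinner (L \<xi>) \<eta> = cinner (L' \<xi>) \<eta>" for \<xi> \<eta>
    by (rule tendsto_unique[OF assms(3) wot_limitD[OF assms(1)] wot_limitD[OF assms(2)]])
qed

lemma wot_limit_add:
  "wot_limit T L G \<Longrightarrow> wot_limit T' L' G \<Longrightarrow> wot_limit (\<lambda>i. T i + T' i) (L + L') G"
  by (auto simp: wot_limit_def blinfun.add_left cinner_add_left intro!: tendsto_add)

lemma wot_limit_scaleC: "wot_limit T L G \<Longrightarrow> wot_limit (\<lambda>i. c *\<^sub>C T i) (c *\<^sub>C L) G"
  by (auto simp: wot_limit_def cinner_scaleC_left intro!: tendsto_mult_left)

lemma wot_limit_const: "wot_limit (\<lambda>i. L) L G"
  by (simp add: wot_limit_def)

text \<open>Compactness is applied to all coefficients, indexed by triples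
  \<open>(y, \<xi>, \<eta>)\<close>, at once. One filter thus serves every \<open>y\<close>, which
  is what lets linearity in \<open>y\<close> pass to the limit. For fixed \<open>y\<close> the
  limiting coefficients form a bounded sesquilinear form, hence an operator.\<close>

lemma wot_limit_along_finer_filter:
  fixes \<Phi> :: "'i \<Rightarrow> 'y \<Rightarrow> 'h::complex_hilbert \<Rightarrow>\<^sub>L 'h"
  assumes "F \<noteq> bot" and bop: "\<And>i y. \<Phi> i y \<in> bop" and bound: "\<And>i y. norm (\<Phi> i y) \<le> b y"
  obtains G \<Psi> where "G \<le> F" "G \<noteq> bot" "\<And>y. \<Psi> y \<in> bop" "\<And>y. norm (\<Psi> y) \<le> b y"
    "\<And>y. wot_limit (\<lambda>i. \<Phi> i y) (\<Psi> y) G"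
proof -
  have b0: "0 \<le> b y" for y
    using order_trans[OF norm_ge_zero bound] .
  have le: "cmod (cinner (\<Phi> i y \<xi>) \<eta>) \<le> b y * norm \<xi> * norm \<eta>" for i y \<xi> \<eta>
  proof -
    have "cmod (cinner (\<Phi> i y \<xi>) \<eta>) \<le> norm (\<Phi> i y \<xi>) * norm \<eta>"
      by (rule cmod_cinner_le)
    also have "\<dots> \<le> norm (\<Phi> i y) * norm \<xi> * norm \<eta>"
      by (intro mult_right_mono norm_blinfun) auto
    also have "\<dots> \<le> b y * norm \<xi> * norm \<eta>"
      by (intro mult_right_mono bound) auto
    finally show ?thesis .
  qed
  obtain G l where G: "G \<le> F" "G \<noteq> bot"
    and lim: "\<And>q. ((\<lambda>i. case q of (y, \<xi>, \<eta>) \<Rightarrow> cinner (\<Phi> i y \<xi>) \<eta>) \<longlongrightarrow> l q) G"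
    by (rule pointwise_limit_along_finer_filter[OF \<open>F \<noteq> bot\<close>,
          of "\<lambda>i (y, \<xi>, \<eta>). cinner (\<Phi> i y \<xi>) \<eta>" "\<lambda>(y, \<xi>, \<eta>). b y * norm \<xi> * norm \<eta>"])
      (use le in auto)
  have lim': "((\<lambda>i. cinner (\<Phi> i y \<xi>) \<eta>) \<longlongrightarrow> l (y, \<xi>, \<eta>)) G" for y \<xi> \<eta>
    using lim[of "(y, \<xi>, \<eta>)"] by simp
  have "\<exists>T\<in>bop. norm T \<le> b y \<and> wot_limit (\<lambda>i. \<Phi> i y) T G" for y
  proof -
    obtain T where "clin T" "\<And>\<xi> \<eta>. cinner (blinfun_apply T \<xi>) \<eta> = l (y, \<xi>, \<eta>)" "norm T \<le> b y"
    proof (rule sesquilinear_form_operator[OF b0, of "\<lambda>\<xi> \<eta>. l (y, \<xi>, \<eta>)" y])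
      fix T
      assume "clin T" "\<And>\<xi> \<eta>. cinner (blinfun_apply T \<xi>) \<eta> = l (y, \<xi>, \<eta>)" "norm T \<le> b y"
      then show thesis
        by (rule that)
    next
      show "cmod (l (y, \<xi>, \<eta>)) \<le> b y * norm \<xi> * norm \<eta>" for \<xi> \<eta>
        by (rule tendsto_upperbound[OF tendsto_norm[OF lim'] _ \<open>G \<noteq> bot\<close>]) (use le in simp)
      show "l (y, \<xi> + \<xi>', \<eta>) = l (y, \<xi>, \<eta>) + l (y, \<xi>', \<eta>)" for \<xi> \<xi>' \<eta>
        using tendsto_add[OF lim'[of y \<xi> \<eta>] lim'[of y \<xi>' \<eta>]] lim'[of y "\<xi> + \<xi>'" \<eta>] \<open>G \<noteq> bot\<close>
        by (auto simp: blinfun.add_right cinner_add_left intro: tendsto_unique)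
      show "l (y, \<xi>, \<eta> + \<eta>') = l (y, \<xi>, \<eta>) + l (y, \<xi>, \<eta>')" for \<xi> \<eta> \<eta>'
        using tendsto_add[OF lim'[of y \<xi> \<eta>] lim'[of y \<xi> \<eta>']] lim'[of y \<xi> "\<eta> + \<eta>'"] \<open>G \<noteq> bot\<close>
        by (auto simp: cinner_add_right intro: tendsto_unique)
      show "l (y, a *\<^sub>C \<xi>, \<eta>) = a * l (y, \<xi>, \<eta>)" for a \<xi> \<eta>
        using tendsto_mult_left[OF lim'[of y \<xi> \<eta>], of a] lim'[of y "a *\<^sub>C \<xi>" \<eta>] \<open>G \<noteq> bot\<close> bop
        by (auto simp: bop_def cinner_scaleC_left intro: tendsto_unique)
      show "l (y, \<xi>, a *\<^sub>C \<eta>) = cnj a * l (y, \<xi>, \<eta>)" for a \<xi> \<eta>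
        using tendsto_mult_left[OF lim'[of y \<xi> \<eta>], of "cnj a"] lim'[of y \<xi> "a *\<^sub>C \<eta>"] \<open>G \<noteq> bot\<close>
        by (auto simp: cinner_scaleC_right intro: tendsto_unique)
    qed
    then show ?thesis
      using lim' by (auto simp: bop_eq_clin wot_limit_def)
  qed
  then obtain \<Psi> where "\<And>y. \<Psi> y \<in> bop" "\<And>y. norm (\<Psi> y) \<le> b y" "\<And>y. wot_limit (\<lambda>i. \<Phi> i y) (\<Psi> y) G"
    by metis
  with G that show ?thesis
    by blast
qed

section \<open>The weak-* topology\<close>

lemma summable_norm_products:
  assumes "summable (\<lambda>n. (norm (\<xi> n))\<^sup>2)" "summable (\<lambda>n. (norm (\<eta> n))\<^sup>2)"
  shows "summable (\<lambda>n. norm (\<xi> n) * norm (\<eta> n) :: real)"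
proof (rule summable_comparison_test[OF _ summable_add[OF assms]], intro exI allI impI)
  fix n
  have "2 * norm (\<xi> n) * norm (\<eta> n) \<le> (norm (\<xi> n))\<^sup>2 + (norm (\<eta> n))\<^sup>2"
    by (rule sum_squares_bound)
  moreover have "0 \<le> norm (\<xi> n) * norm (\<eta> n)"
    by simp
  ultimately show "norm (norm (\<xi> n) * norm (\<eta> n)) \<le> (norm (\<xi> n))\<^sup>2 + (norm (\<eta> n))\<^sup>2"
    unfolding real_norm_def by linarith
qed

text \<open>Dominated convergence for series: the uniform bound on the operators dominates the terms
  by a multiple of \<open>norm (\<xi> n) * norm (\<eta> n)\<close>. This is how bounded weak
  operator convergence becomes weak-* convergence.\<close>

lemma predual_tendsto:
  assumes "wot_limit T L G" "\<And>i. norm (T i) \<le> b" "\<phi> \<in> predual"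
  shows "((\<lambda>i. \<phi> (T i)) \<longlongrightarrow> \<phi> L) G"
proof (cases "G = bot")
  case False
  from assms(3) obtain \<xi> \<eta> where sm: "summable (\<lambda>n. (norm (\<xi> n))\<^sup>2)" "summable (\<lambda>n. (norm (\<eta> n))\<^sup>2)"
    and \<phi>: "\<phi> = (\<lambda>T. \<Sum>n. cinner (blinfun_apply T (\<xi> n)) (\<eta> n))"
    by (auto simp: predual_def)
  have "norm (cinner (T i (\<xi> n)) (\<eta> n)) \<le> b * (norm (\<xi> n) * norm (\<eta> n))" for i n
  proof -
    have "norm (cinner (T i (\<xi> n)) (\<eta> n)) \<le> norm (T i (\<xi> n)) * norm (\<eta> n)"
      by (rule cmod_cinner_le)
    also have "\<dots> \<le> norm (T i) * norm (\<xi> n) * norm (\<eta> n)"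
      by (intro mult_right_mono norm_blinfun) auto
    also have "\<dots> \<le> b * norm (\<xi> n) * norm (\<eta> n)"
      by (intro mult_right_mono assms(2)) auto
    finally show ?thesis
      by (simp add: mult.assoc)
  qed
  then have "eventually (\<lambda>(n, i). norm (cinner (T i (\<xi> n)) (\<eta> n)) \<le> b * (norm (\<xi> n) * norm (\<eta> n)))
      (at_top \<times>\<^sub>F G)"
    by (intro always_eventually) auto
  from tannerys_theorem[OF wot_limitD[OF assms(1)] this
      summable_mult[OF summable_norm_products[OF sm]] False]
  show ?thesis
    by (simp add: \<phi>)
qed simp

lemma topspace_weak_star [simp]: "topspace weak_star = bop"
proof -
  \<comment> \<open>Any normal functional together with the open set \<open>UNIV\<close> contributes
    all of \<open>bop\<close> to the generating family; the zero functional is the simplest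
    witness.\<close>
  have "(\<lambda>T. 0) \<in> predual"
    by (auto simp: predual_def intro!: exI[of _ "\<lambda>_. 0"])
  then show ?thesis
    unfolding weak_star_def topology_generated_by_topspace by blast
qed

lemma wot_limit_imp_limitin_weak_star:
  fixes T :: "'i \<Rightarrow> 'h::complex_hilbert \<Rightarrow>\<^sub>L 'h"
  assumes "wot_limit T L G" "\<And>i. norm (T i) \<le> b" "\<And>i. T i \<in> bop" "L \<in> bop"
  shows "limitin weak_star T L G"
  unfolding limitin_def
proof (intro conjI allI impI)
  fix U
  assume "openin weak_star U \<and> L \<in> U"
  then have "generate_topology_on {{T \<in> bop. \<phi> T \<in> U} | \<phi> U. \<phi> \<in> predual \<and> open U} U" "L \<in> U"
    by (auto simp: weak_star_def openin_topology_generated_by_iff)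
  then show "eventually (\<lambda>i. T i \<in> U) G"
  proof (induction rule: generate_topology_on.induct)
    case (UN K)
    then obtain k where "k \<in> K" "eventually (\<lambda>i. T i \<in> k) G"
      by blast
    then show ?case
      by (auto elim: eventually_mono)
  next
    case (Basis s)
    then obtain \<phi> V where s: "s = {T \<in> bop. \<phi> T \<in> V}" "\<phi> \<in> predual" "open V"
      by blast
    then have "eventually (\<lambda>i. \<phi> (T i) \<in> V) G"
      using Basis(2) topological_tendstoD[OF predual_tendsto[OF assms(1,2) s(2)] s(3)] by simp
    then show ?case
      using s assms(3) by simp
  qed (auto intro: eventually_conj)
qed (simp add: \<open>L \<in> bop\<close>)

text \<open>A normal functional given by vectors \<open>\<xi> n\<close>, \<open>\<eta> n\<close>
  pulls back to the one given by \<open>B (\<xi> n)\<close>, \<open>A (\<eta> n)\<close>, and these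
  stay square summable since \<open>A\<close> and \<open>B\<close> are bounded.\<close>

lemma continuous_map_weak_star_compress:
  fixes A B :: "'h::complex_hilbert \<Rightarrow>\<^sub>L 't::complex_hilbert"
  assumes "clin A" "clin B"
  shows "continuous_map weak_star weak_star (\<lambda>y. adj A o\<^sub>L y o\<^sub>L B)"
  unfolding weak_star_def[where ?'h = 'h] continuous_on_generated_topo_iff
proof (intro conjI allI impI)
  let ?f = "\<lambda>y. adj A o\<^sub>L y o\<^sub>L B"
  fix U :: "('h \<Rightarrow>\<^sub>L 'h) set"
  assume "U \<in> {{T \<in> bop. \<phi> T \<in> V} | \<phi> V. \<phi> \<in> predual \<and> open V}"
  then obtain \<phi> V where U: "U = {T \<in> bop. \<phi> T \<in> V}" "\<phi> \<in> predual" "open V"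
    by blast
  then obtain \<xi> \<eta> where sm: "summable (\<lambda>n. (norm (\<xi> n))\<^sup>2)" "summable (\<lambda>n. (norm (\<eta> n))\<^sup>2)"
    and \<phi>: "\<phi> = (\<lambda>T. \<Sum>n. cinner (blinfun_apply T (\<xi> n)) (\<eta> n))"
    by (auto simp: predual_def)
  have sm_image: "summable (\<lambda>n. (norm (C (\<zeta> n)))\<^sup>2)"
    if "summable (\<lambda>n. (norm (\<zeta> n))\<^sup>2)" for C :: "'h \<Rightarrow>\<^sub>L 't" and \<zeta>
  proof (rule summable_comparison_test[OF _ summable_mult[OF that]], intro exI allI impI)
    fix n
    have "(norm (C (\<zeta> n)))\<^sup>2 \<le> (norm C * norm (\<zeta> n))\<^sup>2"
      by (intro power_mono norm_blinfun) auto
    then show "norm ((norm (C (\<zeta> n)))\<^sup>2) \<le> (norm C)\<^sup>2 * (norm (\<zeta> n))\<^sup>2"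
      by (simp add: power_mult_distrib)
  qed
  have "(\<lambda>y. \<phi> (?f y)) \<in> predual"
    unfolding predual_def
    by (rule CollectI, rule exI[of _ "\<lambda>n. B (\<xi> n)"], rule exI[of _ "\<lambda>n. A (\<eta> n)"])
      (simp add: sm_image sm \<phi> cinner_adj_left[OF assms(1)])
  then have "openin weak_star {y \<in> bop. \<phi> (?f y) \<in> V}"
    unfolding weak_star_def
    by (intro topology_generated_by_Basis CollectI exI[of _ "\<lambda>y. \<phi> (?f y)"] exI[of _ V] conjI refl U(3))
  also have "{y \<in> bop. \<phi> (?f y) \<in> V} = ?f -` U \<inter> topspace weak_star"
    unfolding U(1) topspace_weak_star using bop_compress[OF assms] by blast
  finally show "openin weak_star (?f -` U \<inter> topspace weak_star)" .
next
  have "\<Union> {{T \<in> bop. \<phi> T \<in> V} | \<phi> V. \<phi> \<in> predual \<and> open V} = (bop :: ('h \<Rightarrow>\<^sub>L 'h) set)"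
    using topspace_weak_star[where ?'a = 'h] unfolding weak_star_def topology_generated_by_topspace .
  then show "(\<lambda>y. adj A o\<^sub>L y o\<^sub>L B) ` topspace weak_star
      \<subseteq> \<Union> {{T \<in> bop. \<phi> T \<in> V} | \<phi> V. \<phi> \<in> predual \<and> open V}"
    unfolding topspace_weak_star using bop_compress[OF assms] by (simp only:) blast
qed

section \<open>The completely bounded projection constant\<close>

lemma lambda_n_le_lambda_cb:
  assumes "1 \<le> n"
  shows "lambda_n n S \<le> lambda_cb S"
  unfolding lambda_cb_def lambda_n_def
proof (rule Inf_superset_mono, clarify)
  fix c P
  assume "projection_onto S P" "cb_norm P \<le> ereal c"
  moreover have "amp_norm n P \<le> cb_norm P"
    unfolding cb_norm_def using assms by (intro SUP_upper) simp
  ultimately show "\<exists>c'. ereal c = ereal c' \<and> (\<exists>P. projection_onto S P \<and> amp_norm n P \<le> ereal c')"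
    using order_trans by blast
qed

lemma mat_norm_1: "mat_norm 1 x = norm (x 0 0)"
proof (rule antisym)
  have l2: "l2n 1 \<xi> = norm (\<xi> 0)" for \<xi> :: "nat \<Rightarrow> 'a"
    by (simp add: l2n_def L2_set_def)
  have mv: "matvec 1 x \<xi> 0 = x 0 0 (\<xi> 0)" for \<xi>
    by (simp add: matvec_def)
  show "mat_norm 1 x \<le> norm (x 0 0)"
    by (rule mat_norm_le) (simp_all only: l2 mv norm_blinfun norm_ge_zero)
  show "norm (x 0 0) \<le> mat_norm 1 x"
    by (rule norm_blinfun_bound[OF mat_norm_nonneg])
      (metis l2 mv l2n_matvec_le[of 1 x "\<lambda>_. \<xi>" for \<xi>])
qed

lemma norm_le_of_amp_norm_le:
  assumes "projection_onto S P" "amp_norm n P \<le> ereal c" "1 \<le> n" "y \<in> bop"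
  shows "norm (P y) \<le> c * norm y"
proof -
  have "amp_norm 1 P \<le> ereal c"
    using amp_norm_mono[OF assms(1,3)] assms(2) by (rule order_trans)
  from amp_norm_leD(2)[OF assms(1) this, of "\<lambda>_ _. y"] show ?thesis
    using \<open>y \<in> bop\<close> by (simp only: mat_norm_1)
qed

text \<open>The substance is one projection that is good at every level. It is a weak operator limit
  of projections good at level \<open>k + 1\<close>: these all fix \<open>S\<close>, and since
  \<open>S\<close> is weak-* closed the limit still maps into it.\<close>

lemma lambda_cb_eq_SUP_lambda_n:
  fixes S :: "('h::complex_hilbert \<Rightarrow>\<^sub>L 'h) set"
  assumes "closedin weak_star S"
  shows "lambda_cb S = (SUP n\<in>{1..}. lambda_n n S)"
proof (rule antisym)
  show "(SUP n\<in>{1..}. lambda_n n S) \<le> lambda_cb S"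
    by (rule SUP_least) (simp add: lambda_n_le_lambda_cb)
  show "lambda_cb S \<le> (SUP n\<in>{1..}. lambda_n n S)"
  proof (rule dense_ge)
    fix z
    assume z: "(SUP n\<in>{1..}. lambda_n n S) < z"
    show "lambda_cb S \<le> z"
    proof (cases z)
      case (real c)
      \<comment> \<open>The infimum defining \<open>lambda_n\<close> may not be attained. The strict
        gap between the supremum and \<open>c\<close> supplies actual projections with one bound
        \<open>c\<close> for all levels.\<close>
      have "\<exists>P. projection_onto S P \<and> amp_norm (Suc k) P \<le> ereal c" for k
      proof -
        have "lambda_n (Suc k) S \<le> (SUP n\<in>{1..}. lambda_n n S)"
          by (rule SUP_upper) simp
        then have "lambda_n (Suc k) S < ereal c"
          using z real by (simp add: order_le_less_trans)
        then obtain c' P where "c' < c" "projection_onto S P" "amp_norm (Suc k) P \<le> ereal c'"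
          unfolding lambda_n_def Inf_less_iff by auto
        then show ?thesis
          by (meson ereal_less_eq(3) less_imp_le order_trans)
      qed
      then obtain P where P: "\<And>k. projection_onto S (P k)" "\<And>k. amp_norm (Suc k) (P k) \<le> ereal c"
        by metis
      note c0 = amp_norm_leD(1)[OF P]
      have "S \<subseteq> bop"
        using closedin_subset[OF assms] by simp
      have inS: "P k y \<in> S" if "y \<in> bop" for k y
        using projection_in[OF P(1) that] .
      \<comment> \<open>Nothing is known about \<open>P k\<close> outside \<open>bop\<close>, while
        the compactness lemma wants operators and norm bounds for every argument; hence the value 0
        there.\<close>
      define \<Phi> where "\<Phi> k y = (if y \<in> bop then P k y else 0)" for k y
      have \<Phi>: "\<Phi> k y \<in> bop" "norm (\<Phi> k y) \<le> c * norm y" for k y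
        using inS \<open>S \<subseteq> bop\<close> norm_le_of_amp_norm_le[OF P] c0 by (auto simp: \<Phi>_def)
      obtain G \<Psi> where G: "G \<le> sequentially" "G \<noteq> bot" and \<Psi>: "\<And>y. \<Psi> y \<in> bop"
        and lim: "\<And>y. wot_limit (\<lambda>k. \<Phi> k y) (\<Psi> y) G"
        by (rule wot_limit_along_finer_filter[of sequentially \<Phi> "\<lambda>y. c * norm y"]) (use \<Phi> in auto)
      have lim': "wot_limit (\<lambda>k. P k y) (\<Psi> y) G" if "y \<in> bop" for y
        using lim[of y] that by (simp add: \<Phi>_def)
      have "projection_onto S \<Psi>"
        unfolding projection_onto_def
      proof (intro conjI ballI allI subsetI)
        show "\<Psi> (T + R) = \<Psi> T + \<Psi> R" if "T \<in> bop" "R \<in> bop" for T R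
        proof (rule wot_limit_unique[OF lim'[OF bop_add[OF that]] _ G(2)])
          show "wot_limit (\<lambda>k. P k (T + R)) (\<Psi> T + \<Psi> R) G"
            using wot_limit_add[OF lim'[OF that(1)] lim'[OF that(2)]]
            by (simp only: projection_add[OF P(1) that])
        qed
        show "\<Psi> (a *\<^sub>C T) = a *\<^sub>C \<Psi> T" if "T \<in> bop" for a T
        proof (rule wot_limit_unique[OF lim'[OF bop_scaleC[OF that]] _ G(2)])
          show "wot_limit (\<lambda>k. P k (a *\<^sub>C T)) (a *\<^sub>C \<Psi> T) G"
            using wot_limit_scaleC[OF lim'[OF that], of a]
            by (simp only: projection_scaleC[OF P(1) that])
        qed
        show "R \<in> S" if "R \<in> \<Psi> ` bop" for R
        proof -
          from that obtain y where y: "y \<in> bop" "R = \<Psi> y"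
            by blast
          have "limitin weak_star (\<lambda>k. \<Phi> k y) (\<Psi> y) G"
            by (rule wot_limit_imp_limitin_weak_star[OF lim \<Phi>(2) \<Phi>(1) \<Psi>])
          then show ?thesis
            unfolding y(2)
            by (rule limitin_closedin[OF _ assms]) (use y inS G(2) in \<open>simp_all add: \<Phi>_def\<close>)
        qed
        show "\<Psi> T = T" if "T \<in> S" for T
        proof (rule wot_limit_unique[OF _ wot_limit_const G(2)])
          show "wot_limit (\<lambda>_. T) (\<Psi> T) G"
            using lim'[of T] that \<open>S \<subseteq> bop\<close> by (auto simp: projection_fixes[OF P(1) that])
        qed
      qed
      moreover have "amp_norm m \<Psi> \<le> ereal c" for m
      proof (rule amp_norm_leI[OF c0], rule mat_norm_le_form)
        fix x :: "nat \<Rightarrow> nat \<Rightarrow> 'h \<Rightarrow>\<^sub>L 'h" and \<xi> \<eta> :: "nat \<Rightarrow> 'h"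
        assume x: "\<And>i j. i < m \<Longrightarrow> j < m \<Longrightarrow> x i j \<in> bop"
        let ?form = "\<lambda>R. \<Sum>i<m. \<Sum>j<m. cinner (blinfun_apply (R (x i j)) (\<xi> j)) (\<eta> i)"
        have form: "(\<Sum>i<m. cinner (matvec m (\<lambda>i j. R (x i j)) \<xi> i) (\<eta> i)) = ?form R" for R
          by (simp add: matvec_def cinner_sum_left)
        have limf: "((\<lambda>k. ?form (P k)) \<longlongrightarrow> ?form \<Psi>) G"
          using x by (intro tendsto_sum wot_limitD lim') auto
        \<comment> \<open>From \<open>k = m\<close> on, \<open>P k\<close> is bounded by
          \<open>c\<close> already at a level not below \<open>m\<close>, so monotonicity gives
          level \<open>m\<close>. The finitely many earlier \<open>k\<close> do not affect the
          limit.\<close>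
        have "eventually (\<lambda>k. cmod (?form (P k)) \<le> c * mat_norm m x * l2n m \<xi> * l2n m \<eta>) G"
        proof (rule filter_leD[OF G(1)], rule eventually_sequentiallyI[of m])
          fix k
          assume "m \<le> k"
          then have "amp_norm m (P k) \<le> ereal c"
            by (intro order_trans[OF amp_norm_mono[OF P(1)] P(2)]) simp
          then have "mat_norm m (\<lambda>i j. P k (x i j)) \<le> c * mat_norm m x"
            using x by (intro amp_norm_leD(2)[OF P(1)])
          then show "cmod (?form (P k)) \<le> c * mat_norm m x * l2n m \<xi> * l2n m \<eta>"
            unfolding form[symmetric]
            by (intro order_trans[OF cinner_matvec_le] mult_right_mono) simp_all
        qed
        then show "cmod (\<Sum>i<m. cinner (matvec m (\<lambda>i j. \<Psi> (x i j)) \<xi> i) (\<eta> i))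
            \<le> c * mat_norm m x * l2n m \<xi> * l2n m \<eta>"
          unfolding form by (intro tendsto_upperbound[OF tendsto_norm[OF limf] _ G(2)])
      qed (simp add: c0 mat_norm_nonneg)
      then have "cb_norm \<Psi> \<le> ereal c"
        unfolding cb_norm_def by (intro SUP_least)
      ultimately show ?thesis
        unfolding lambda_cb_def real by (intro Inf_lower) blast
    qed (use z in auto)
  qed
qed


section \<open>Amplification along a family of isometries\<close>

text \<open>Arbitrary index sets are allowed because an orthonormal basis may be uncountable and the
  limit runs over its finite subsets.\<close>

definition frame_on :: "'i set \<Rightarrow> ('i \<Rightarrow> 'a::complex_hilbert \<Rightarrow>\<^sub>L 'b::complex_hilbert) \<Rightarrow> bool" where
  "frame_on I J \<longleftrightarrow> (\<forall>i. clin (J i)) \<and>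
     (\<forall>i\<in>I. \<forall>j\<in>I. \<forall>x y. cinner (J i x) (J j y) = (if i = j then cinner x y else 0))"

lemma frame_on_subset: "frame_on I J \<Longrightarrow> I' \<subseteq> I \<Longrightarrow> frame_on I' J"
  unfolding frame_on_def by blast

lemma frame_reindex:
  assumes "frame_on I J" "inj_on g {..<n}" "g ` {..<n} \<subseteq> I"
  shows "frame n (\<lambda>i. J (g i))"
  unfolding frame_def
proof (intro conjI allI impI)
  show "cinner (J (g i) x) (J (g j) y) = (if i = j then cinner x y else 0)" if "i < n" "j < n" for i j x y
  proof -
    have "g i \<in> I" "g j \<in> I" "g i = g j \<longleftrightarrow> i = j"
      using assms(2,3) that by (auto simp: inj_on_def)
    then show ?thesis
      using assms(1) by (simp add: frame_on_def)
  qed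
qed (use assms(1) in \<open>simp add: frame_on_def\<close>)

definition amplify where
  "amplify I J P y = (\<Sum>i\<in>I. \<Sum>j\<in>I. J i o\<^sub>L P (adj (J i) o\<^sub>L y o\<^sub>L J j) o\<^sub>L adj (J j))"

lemma norm_amplify_le:
  assumes J: "frame_on I J" and "finite I"
    and P: "projection_onto S P" "amp_norm (card I) P \<le> ereal c" and "y \<in> bop"
  shows "norm (amplify I J P y) \<le> c * norm y"
proof -
  obtain g where g: "bij_betw g {..<card I} I"
    using ex_bij_betw_nat_finite[OF \<open>finite I\<close>] by (auto simp: atLeast0LessThan)
  have fr: "frame (card I) (\<lambda>i. J (g i))"
    using g by (intro frame_reindex[OF J]) (auto simp: bij_betw_def)
  have "amplify I J P y = (\<Sum>k<card I. \<Sum>j\<in>I. J (g k) o\<^sub>L P (adj (J (g k)) o\<^sub>L y o\<^sub>L J j) o\<^sub>L adj (J j))"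
    unfolding amplify_def
    by (rule sum.reindex_bij_betw[OF g, symmetric,
          of "\<lambda>i. \<Sum>j\<in>I. J i o\<^sub>L P (adj (J i) o\<^sub>L y o\<^sub>L J j) o\<^sub>L adj (J j)"])
  also have "\<dots> = assemble (card I) (\<lambda>i. J (g i)) (\<lambda>i. J (g i))
      (\<lambda>k l. P (adj (J (g k)) o\<^sub>L y o\<^sub>L J (g l)))"
    unfolding assemble_def
  proof (rule sum.cong[OF refl])
    fix k
    show "(\<Sum>j\<in>I. J (g k) o\<^sub>L P (adj (J (g k)) o\<^sub>L y o\<^sub>L J j) o\<^sub>L adj (J j))
        = (\<Sum>l<card I. J (g k) o\<^sub>L P (adj (J (g k)) o\<^sub>L y o\<^sub>L J (g l)) o\<^sub>L adj (J (g l)))"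
      by (rule sum.reindex_bij_betw[OF g, symmetric,
            of "\<lambda>j. J (g k) o\<^sub>L P (adj (J (g k)) o\<^sub>L y o\<^sub>L J j) o\<^sub>L adj (J j)"])
  qed
  finally show ?thesis
    using norm_amplification_le[OF fr P \<open>y \<in> bop\<close>] by simp
qed

lemma compress_add: "A o\<^sub>L (T + R) o\<^sub>L B = (A o\<^sub>L T o\<^sub>L B) + (A o\<^sub>L R o\<^sub>L B)"
  by (simp only: bounded_bilinear.add_left[OF bounded_bilinear_blinfun_compose]
      bounded_bilinear.add_right[OF bounded_bilinear_blinfun_compose])

lemma compress_scaleC: "clin A \<Longrightarrow> A o\<^sub>L (c *\<^sub>C T) o\<^sub>L B = c *\<^sub>C (A o\<^sub>L T o\<^sub>L B)"
  by (simp only: compose_scaleC_right compose_scaleC_left)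

lemma amplify_add:
  assumes "\<And>i. clin (J i)" "projection_onto S P" "T \<in> bop" "R \<in> bop"
  shows "amplify I J P (T + R) = amplify I J P T + amplify I J P R"
  unfolding amplify_def compress_add
  using assms
  by (simp only: projection_add[OF assms(2)] bop_compress compress_add sum.distrib)

lemma amplify_scaleC:
  assumes "\<And>i. clin (J i)" "projection_onto S P" "T \<in> bop"
  shows "amplify I J P (c *\<^sub>C T) = c *\<^sub>C amplify I J P T"
  using assms
  by (simp add: amplify_def compress_scaleC clin_adj projection_scaleC[OF assms(2)] bop_compress
      sum_scaleC_right)

lemma amplify_in:
  assumes "\<And>i. clin (J i)" "projection_onto S P" "y \<in> bop" "csubspace M"
    and "\<And>x i j. x \<in> S \<Longrightarrow> i \<in> I \<Longrightarrow> j \<in> I \<Longrightarrow> J i o\<^sub>L x o\<^sub>L adj (J j) \<in> M"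
  shows "amplify I J P y \<in> M"
  unfolding amplify_def
  using assms by (intro complex_vector.subspace_sum[OF assms(4)] assms(5) projection_in[OF assms(2)] bop_compress)

section \<open>Matrix spaces\<close>

lemma cinner_axis_right: "cinner \<zeta> (axis i y) = cinner (\<zeta> $ i) y"
proof -
  have "cinner \<zeta> (axis i y) = (\<Sum>k\<in>UNIV. if k = i then cinner (\<zeta> $ k) y else 0)"
    unfolding cinner_vec_def by (rule sum.cong[OF refl]) (simp add: axis_def)
  then show ?thesis
    by simp
qed

lemma norm_axis_eq: "norm (axis i x) = norm (x :: 'a::complex_hilbert)"
proof -
  have "complex_of_real ((norm (axis i x))\<^sup>2) = of_real ((norm x)\<^sup>2)"
    unfolding cinner_self[symmetric] cinner_axis_right by (simp add: axis_def)
  then show ?thesis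
    by (simp only: of_real_eq_iff) simp
qed

lift_definition coord :: "'n::finite \<Rightarrow> 'h::complex_hilbert \<Rightarrow>\<^sub>L ('h ^ 'n)" is axis
proof
  fix i :: 'n and x y :: 'h and r :: real
  show "axis i (x + y) = axis i x + axis i y" "axis i (r *\<^sub>R x) = r *\<^sub>R axis i x"
    by (simp_all add: vec_eq_iff axis_def)
  show "\<exists>K. \<forall>x :: 'h. norm (axis i x) \<le> norm x * K"
    by (rule exI[of _ 1]) (simp add: norm_axis_eq)
qed

lemma clin_coord: "clin (coord i)"
  by (simp add: clin_def coord.rep_eq vec_eq_iff axis_def scaleC_vec_def)

lemma adj_coord: "adj (coord i) \<zeta> = \<zeta> $ i"
  by (rule cinner_ext) (simp add: cinner_adj_left[OF clin_coord] coord.rep_eq cinner_axis_right)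

lemma frame_on_coord: "frame_on UNIV coord"
  by (auto simp: frame_on_def clin_coord coord.rep_eq cinner_axis_right) (simp_all add: axis_def)

lemma sum_coord: "(\<Sum>j\<in>UNIV. coord j (\<zeta> $ j)) = \<zeta>"
  by (simp add: coord.rep_eq vec_eq_iff axis_def)

text \<open>The matrix entries are necessarily the compressions by the coordinate embeddings. In
  this form membership matches the hypotheses of \<open>lambda_n_le_lambda_frame\<close>.\<close>

lemma mem_matrix_space_iff:
  fixes T :: "('h::complex_hilbert ^ 'n::finite) \<Rightarrow>\<^sub>L ('h ^ 'n)"
  shows "T \<in> matrix_space S \<longleftrightarrow> T \<in> bop \<and> (\<forall>i j. adj (coord i) o\<^sub>L T o\<^sub>L coord j \<in> S)"
proof safe
  assume "T \<in> matrix_space S"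
  then obtain x where x: "\<And>i j. x i j \<in> S"
    and T: "\<And>\<xi> i. T \<xi> $ i = (\<Sum>j\<in>UNIV. blinfun_apply (x i j) (\<xi> $ j))"
    by (auto simp: matrix_space_def)
  show "adj (coord i) o\<^sub>L T o\<^sub>L coord j \<in> S" for i j
  proof -
    have "adj (coord i) o\<^sub>L T o\<^sub>L coord j = x i j"
    proof (rule blinfun_eqI)
      fix h
      have "(adj (coord i) o\<^sub>L T o\<^sub>L coord j) h = (\<Sum>j'\<in>UNIV. if j' = j then x i j' h else 0)"
        by (simp add: adj_coord T coord.rep_eq axis_def if_distrib cong: if_cong)
      then show "(adj (coord i) o\<^sub>L T o\<^sub>L coord j) h = x i j h"
        by simp
    qed
    then show ?thesis
      using x by simp
  qed
next
  assume T: "T \<in> bop" "\<forall>i j. adj (coord i) o\<^sub>L T o\<^sub>L coord j \<in> S"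
  have "T \<xi> $ i = (\<Sum>j\<in>UNIV. (adj (coord i) o\<^sub>L T o\<^sub>L coord j) (\<xi> $ j))" for \<xi> i
  proof -
    have "T \<xi> $ i = adj (coord i) (T (\<Sum>j\<in>UNIV. coord j (\<xi> $ j)))"
      by (simp add: sum_coord adj_coord)
    then show ?thesis
      by (simp add: blinfun.sum_right)
  qed
  with T show "T \<in> matrix_space S"
    unfolding matrix_space_def
    by (intro CollectI conjI exI[of _ "\<lambda>i j. adj (coord i) o\<^sub>L T o\<^sub>L coord j"]) auto
qed (simp add: matrix_space_def)

lemma lambda_n_eq_lambda_matrix_space:
  fixes S :: "('h::complex_hilbert \<Rightarrow>\<^sub>L 'h) set"
  assumes "S \<subseteq> bop" "csubspace S"
  shows "lambda_n CARD('n::finite) S = lambda (matrix_space S :: (('h ^ 'n) \<Rightarrow>\<^sub>L ('h ^ 'n)) set)"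
proof (rule antisym)
  let ?M = "matrix_space S :: (('h ^ 'n) \<Rightarrow>\<^sub>L ('h ^ 'n)) set"
  have M_bop: "?M \<subseteq> bop"
    by (auto simp: matrix_space_def)
  have embed: "coord i o\<^sub>L x o\<^sub>L adj (coord j) \<in> ?M" if "x \<in> S" for x and i j :: 'n
    unfolding mem_matrix_space_iff
  proof (intro conjI allI)
    show "coord i o\<^sub>L x o\<^sub>L adj (coord j) \<in> bop"
      using that assms(1) by (auto simp: bop_eq_clin intro!: clin_compose clin_adj clin_coord)
    show "adj (coord i') o\<^sub>L (coord i o\<^sub>L x o\<^sub>L adj (coord j)) o\<^sub>L coord j' \<in> S" for i' j'
    proof -
      have "adj (coord i') o\<^sub>L (coord i o\<^sub>L x o\<^sub>L adj (coord j)) o\<^sub>L coord j'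
          = (if i' = i \<and> j' = j then x else 0)"
        by (rule blinfun_eqI) (auto simp: adj_coord coord.rep_eq axis_def)
      then show ?thesis
        using that complex_vector.subspace_0[OF assms(2)] by simp
    qed
  qed
  obtain g :: "nat \<Rightarrow> 'n" where g: "bij_betw g {..<CARD('n)} UNIV"
    using ex_bij_betw_nat_finite[of "UNIV :: 'n set"] by (auto simp: atLeast0LessThan)
  have fr: "frame CARD('n) (\<lambda>i. coord (g i))"
    using g by (intro frame_reindex[OF frame_on_coord]) (auto simp: bij_betw_def)
  show "lambda_n CARD('n) S \<le> lambda ?M"
    by (rule lambda_n_le_lambda_frame[OF _ assms(2,1) fr M_bop])
      (simp add: Suc_le_eq, simp add: mem_matrix_space_iff, rule embed)
  have "csubspace ?M"
    using assms(2)
    by (auto simp: complex_vector.subspace_def[of ?M] mem_matrix_space_iff compress_add compress_scaleC clin_adj clin_coord bop_add bop_scaleC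
        complex_vector.subspace_0 complex_vector.subspace_add complex_vector.subspace_scale)
  show "lambda ?M \<le> lambda_n CARD('n) S"
    unfolding lambda_def lambda_n_def
  proof (rule Inf_superset_mono, clarify)
    fix c P
    assume P: "projection_onto S P" "amp_norm CARD('n) P \<le> ereal c"
    let ?Q = "amplify (UNIV :: 'n set) coord P"
    have "projection_onto ?M ?Q"
      unfolding projection_onto_def
    proof (intro conjI ballI allI subsetI)
      show "?Q (T + R) = ?Q T + ?Q R" if "T \<in> bop" "R \<in> bop" for T R
        by (rule amplify_add[OF clin_coord P(1) that])
      show "?Q (a *\<^sub>C T) = a *\<^sub>C ?Q T" if "T \<in> bop" for a T
        by (rule amplify_scaleC[OF clin_coord P(1) that])
      show "R \<in> ?M" if "R \<in> ?Q ` bop" for R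
        using that amplify_in[where J = coord and I = "UNIV :: 'n set",
            OF clin_coord P(1) _ \<open>csubspace ?M\<close> embed] by blast
      show "?Q T = T" if "T \<in> ?M" for T
      proof (rule blinfun_eqI)
        fix \<zeta>
        have "P (adj (coord i) o\<^sub>L T o\<^sub>L coord j) = adj (coord i) o\<^sub>L T o\<^sub>L coord j" for i j
          using that projection_fixes[OF P(1)] by (simp add: mem_matrix_space_iff)
        \<comment> \<open>As \<open>P\<close> fixes the entries of \<open>T\<close>, the inner sum
          only reassembles \<open>\<zeta>\<close> from its coordinates and the outer one reassembles
          \<open>T \<zeta>\<close>.\<close>
        then have "?Q T \<zeta> = (\<Sum>i\<in>UNIV. coord i (T (\<Sum>j\<in>UNIV. coord j (\<zeta> $ j)) $ i))"
          by (simp add: amplify_def blinfun.sum_left blinfun.sum_right adj_coord)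
        then show "?Q T \<zeta> = T \<zeta>"
          by (simp only: sum_coord)
      qed
    qed
    moreover have "map_norm ?Q \<le> ereal c"
      using amp_norm_leD(1)[OF P] norm_amplify_le[OF frame_on_coord _ P(1)] P(2)
      by (intro map_norm_leI) auto
    ultimately show "\<exists>c'. ereal c = ereal c' \<and> (\<exists>P. projection_onto ?M P \<and> map_norm P \<le> ereal c')"
      by blast
  qed
qed

section \<open>Orthonormal bases\<close>

definition orthonormal :: "'k::complex_hilbert set \<Rightarrow> bool" where
  "orthonormal E \<longleftrightarrow> (\<forall>x\<in>E. \<forall>y\<in>E. cinner x y = (if x = y then 1 else 0))"

text \<open>Stated through the orthogonal complement, as this is what maximality of an orthonormal
  set yields; density is recovered from it by orthogonal projection.\<close>

definition total_set :: "'k::complex_hilbert set \<Rightarrow> bool" where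
  "total_set E \<longleftrightarrow> (\<forall>x. (\<forall>e\<in>E. cinner x e = 0) \<longrightarrow> x = 0)"

text \<open>Zorn's lemma: a nonzero vector orthogonal to a maximal orthonormal set could be
  normalised and added to it.\<close>

lemma orthonormal_basis_exists: "\<exists>E :: 'k::complex_hilbert set. orthonormal E \<and> total_set E"
proof -
  have "\<exists>M\<in>Collect orthonormal. \<forall>X\<in>Collect orthonormal. M \<subseteq> X \<longrightarrow> X = (M :: 'k set)"
  proof (rule subset_Zorn')
    fix C :: "'k set set"
    assume C: "subset.chain (Collect orthonormal) C"
    have "cinner x y = (if x = y then 1 else 0)" if "x \<in> X" "X \<in> C" "y \<in> Y" "Y \<in> C" for x y X Y
    proof -
      have "X \<subseteq> Y \<or> Y \<subseteq> X" "orthonormal X" "orthonormal Y"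
        using C that by (auto simp: subset_chain_def)
      then show ?thesis
        using that unfolding orthonormal_def by blast
    qed
    then show "\<Union>C \<in> Collect orthonormal"
      by (auto simp: orthonormal_def)
  qed
  then obtain E :: "'k set" where E: "orthonormal E" and max: "\<And>X. orthonormal X \<Longrightarrow> E \<subseteq> X \<Longrightarrow> X = E"
    by blast
  have "x = 0" if x: "\<forall>e\<in>E. cinner x e = 0" for x
  proof (rule ccontr)
    assume "x \<noteq> 0"
    define u where "u = complex_of_real (inverse (norm x)) *\<^sub>C x"
    have "norm u = 1"
      using \<open>x \<noteq> 0\<close> by (simp only: u_def norm_scaleC norm_of_real) simp
    then have "cinner u u = 1"
      by (simp add: cinner_self)
    moreover have "cinner u e = 0" "cinner e u = 0" if "e \<in> E" for e
      using x that cinner_commute[of e u] by (simp_all add: u_def cinner_scaleC_left)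
    ultimately have "orthonormal (insert u E)"
      using E unfolding orthonormal_def by (metis insert_iff zero_neq_one)
    then have "u \<in> E"
      using max[of "insert u E"] by blast
    then show False
      using \<open>\<And>e. e \<in> E \<Longrightarrow> cinner u e = 0\<close>[of u] \<open>cinner u u = 1\<close> by simp
  qed
  with E show ?thesis
    unfolding total_set_def by blast
qed

text \<open>Subtracting the finite Fourier expansion of \<open>x\<close> leaves a vector orthogonal
  to \<open>E\<close>. The use is contrapositive: in infinite dimension every orthonormal basis is
  infinite.\<close>

lemma finite_orthonormal_basis_spans:
  assumes "orthonormal E" "total_set E" "finite E"
  shows "cspan E = UNIV"
proof -
  have "x \<in> cspan E" for x
  proof -
    define p where "p = (\<Sum>e\<in>E. cinner x e *\<^sub>C e)"
    have "cinner (x - p) f = 0" if "f \<in> E" for f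
    proof -
      have "cinner p f = (\<Sum>e\<in>E. if e = f then cinner x e else 0)"
        unfolding p_def cinner_sum_left cinner_scaleC_left
        using assms(1) that by (intro sum.cong refl) (simp add: orthonormal_def)
      then show ?thesis
        using \<open>finite E\<close> that by (simp add: cinner_diff_left)
    qed
    then have "x - p = 0"
      using assms(2) unfolding total_set_def by blast
    moreover have "p \<in> cspan E"
      unfolding p_def
      by (intro complex_vector.span_sum complex_vector.span_scale complex_vector.span_base)
    ultimately show ?thesis
      by simp
  qed
  then show ?thesis
    by blast
qed

lemma closed_subspace_eq_UNIV:
  assumes "total_set E" "closed V" "csubspace V" "E \<subseteq> V"
  shows "V = UNIV"
proof -
  have "x \<in> V" for x
  proof -
    obtain m where m: "m \<in> V" "\<And>y. y \<in> V \<Longrightarrow> cinner (x - m) y = 0"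
      using orthogonal_projection_exists[OF assms(2,3)] by metis
    then have "x - m = 0"
      using assms(1,4) unfolding total_set_def by blast
    with m show ?thesis
      by simp
  qed
  then show ?thesis
    by blast
qed


section \<open>Tensor products\<close>

lemma csubspace_closure:
  fixes M :: "('a::complex_hilbert \<Rightarrow>\<^sub>L 'a) set"
  assumes "csubspace M"
  shows "csubspace (closure M)"
  unfolding complex_vector.subspace_def
proof (intro conjI ballI allI)
  show "0 \<in> closure M"
    using complex_vector.subspace_0[OF assms] closure_subset by blast
  fix x y
  assume x: "x \<in> closure M"
  show "c *\<^sub>C x \<in> closure M" for c
  proof -
    obtain s where s: "\<And>n. s n \<in> M" "s \<longlonglongrightarrow> x"
      using x unfolding closure_sequential by blast
    \<comment> \<open>The operators do not form a Hilbert space, so the boundedness of scaling comes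
      from the pointwise estimate.\<close>
    have "bounded_linear (\<lambda>x :: 'a \<Rightarrow>\<^sub>L 'a. c *\<^sub>C x)"
    proof
      show "c *\<^sub>C (r *\<^sub>R x) = r *\<^sub>R (c *\<^sub>C x)" for r and x :: "'a \<Rightarrow>\<^sub>L 'a"
        by (simp add: scaleC_of_real[symmetric] scaleC_scaleC mult.commute)
      show "\<exists>K. \<forall>x :: 'a \<Rightarrow>\<^sub>L 'a. norm (c *\<^sub>C x) \<le> norm x * K"
      proof (intro exI allI)
        show "norm (c *\<^sub>C x) \<le> norm x * cmod c" for x :: "'a \<Rightarrow>\<^sub>L 'a"
          by (rule norm_blinfun_bound)
            (simp_all add: norm_scaleC mult.assoc mult.left_commute mult_left_mono norm_blinfun)
      qed
    qed (rule scaleC_add_right)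
    then have "(\<lambda>n. c *\<^sub>C s n) \<longlonglongrightarrow> c *\<^sub>C x"
      using s(2) by (rule bounded_linear.tendsto)
    then show ?thesis
      unfolding closure_sequential
      by (intro exI[of _ "\<lambda>n. c *\<^sub>C s n"] conjI allI complex_vector.subspace_scale[OF assms] s(1))
  qed
  assume y: "y \<in> closure M"
  obtain s where s: "\<And>n. s n \<in> M" "s \<longlonglongrightarrow> x"
    using x unfolding closure_sequential by blast
  obtain t where t: "\<And>n. t n \<in> M" "t \<longlonglongrightarrow> y"
    using y unfolding closure_sequential by blast
  show "x + y \<in> closure M"
    unfolding closure_sequential
    by (intro exI[of _ "\<lambda>n. s n + t n"] conjI allI tendsto_add s t
        complex_vector.subspace_add[OF assms])
qed

context
  fixes tens :: "'k::complex_hilbert \<Rightarrow> 'h::complex_hilbert \<Rightarrow> 't::complex_hilbert"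
  assumes tens: "hilbert_tensor tens"
begin

lemma tens_add_left: "tens (k + k') h = tens k h + tens k' h"
  and tens_add_right: "tens k (h + h') = tens k h + tens k h'"
  and tens_scaleC_left: "tens (c *\<^sub>C k) h = c *\<^sub>C tens k h"
  and tens_scaleC_right: "tens k (c *\<^sub>C h) = c *\<^sub>C tens k h"
  and cinner_tens: "cinner (tens k h) (tens k' h') = cinner k k' * cinner h h'"
  and closure_span_tens: "closure (cspan {tens k h | k h. True}) = UNIV"
  using tens by (simp_all add: hilbert_tensor_def)

lemma norm_tens: "norm (tens k h) = norm k * norm h"
proof -
  have "complex_of_real ((norm (tens k h))\<^sup>2) = of_real ((norm k * norm h)\<^sup>2)"
    unfolding cinner_self[symmetric] cinner_tens by (simp add: cinner_self power_mult_distrib)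
  then have "(norm (tens k h))\<^sup>2 = (norm k * norm h)\<^sup>2"
    by (simp only: of_real_eq_iff)
  then show ?thesis
    by simp
qed

text \<open>For unit vectors \<open>k\<close> these are the isometries that embed the second factor.
  Compressing an operator \<open>y\<close> by two of them extracts a block of \<open>y\<close>, and
  for orthonormal vectors they form a frame.\<close>

definition slice :: "'k \<Rightarrow> 'h \<Rightarrow>\<^sub>L 't" where
  "slice k = Blinfun (tens k)"

lemma slice_apply: "slice k h = tens k h"
proof -
  have "bounded_linear (tens k)"
  proof
    show "tens k (r *\<^sub>R h) = r *\<^sub>R tens k h" for r h
      using tens_scaleC_right[of k "of_real r" h] by (simp add: scaleC_of_real)
    show "\<exists>K. \<forall>h. norm (tens k h) \<le> norm h * K"
      by (rule exI[of _ "norm k"]) (simp add: norm_tens mult.commute)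
  qed (rule tens_add_right)
  then show ?thesis
    by (simp add: slice_def bounded_linear_Blinfun_apply)
qed

lemma clin_slice: "clin (slice k)"
  by (simp add: clin_def slice_apply tens_scaleC_right)

lemma adj_slice: "adj (slice k) (tens k' h) = cinner k' k *\<^sub>C h"
  by (rule cinner_ext) (simp add: cinner_adj_left[OF clin_slice] slice_apply cinner_tens cinner_scaleC_left)

lemma frame_on_slice: "orthonormal E \<Longrightarrow> frame_on E slice"
  by (simp add: frame_on_def clin_slice slice_apply cinner_tens orthonormal_def)

lemma bounded_linear_tens_left: "bounded_linear (\<lambda>k. tens k h)"
proof
  show "tens (r *\<^sub>R k) h = r *\<^sub>R tens k h" for r k
    using tens_scaleC_left[of "of_real r" k h] by (simp add: scaleC_of_real)
  show "\<exists>K. \<forall>k. norm (tens k h) \<le> norm k * K"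
    by (rule exI[of _ "norm h"]) (simp add: norm_tens)
qed (rule tens_add_left)

text \<open>For fixed \<open>h\<close> the vectors \<open>k\<close> with \<open>tens k h\<close> in
  \<open>V\<close> form a closed subspace containing \<open>E\<close>, hence all \<open>k\<close>
  qualify; the elementary tensors then span a dense subspace.\<close>

lemma closed_subspace_tens_eq_UNIV:
  assumes "total_set E" "closed V" "csubspace V" "\<And>e h. e \<in> E \<Longrightarrow> tens e h \<in> V"
  shows "V = UNIV"
proof -
  have "tens k h \<in> V" for k h
  proof -
    have "{k. tens k h \<in> V} = UNIV"
    proof (rule closed_subspace_eq_UNIV[OF assms(1)])
      show "closed {k. tens k h \<in> V}"
        using continuous_closed_vimage[OF assms(2), of "\<lambda>k. tens k h"]
          linear_continuous_at[OF bounded_linear_tens_left] by (simp add: vimage_def)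
      have "tens 0 h = 0"
        using norm_tens[of 0 h] by simp
      then show "csubspace {k. tens k h \<in> V}"
        using assms(3) unfolding complex_vector.subspace_def
        by (simp add: tens_add_left tens_scaleC_left)
    qed (use assms(4) in auto)
    then show ?thesis
      by blast
  qed
  then have "cspan {tens k h | k h. True} \<subseteq> V"
    by (intro complex_vector.span_minimal assms(3)) auto
  then have "closure (cspan {tens k h | k h. True}) \<subseteq> V"
    by (rule closure_minimal[OF _ assms(2)])
  then show ?thesis
    using closure_span_tens by auto
qed

text \<open>Density is used twice, first in the second argument of the inner product and then in the
  argument of the operators. Only coefficients at basis vectors need checking, and for the finite
  amplifications these are eventually constant.\<close>

lemma bop_eq_of_tens:
  assumes "total_set E" "T \<in> bop" "R \<in> bop"
    and eq: "\<And>e e' h h'. e \<in> E \<Longrightarrow> e' \<in> E \<Longrightarrow>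
      cinner (T (tens e h)) (tens e' h') = cinner (R (tens e h)) (tens e' h')"
  shows "T = R"
proof -
  have inner: "cinner (T (tens e h)) \<zeta>' = cinner (R (tens e h)) \<zeta>'" if "e \<in> E" for e h \<zeta>'
  proof -
    have "{\<zeta>'. cinner (T (tens e h)) \<zeta>' = cinner (R (tens e h)) \<zeta>'} = UNIV"
    proof (rule closed_subspace_tens_eq_UNIV[OF assms(1)])
      show "closed {\<zeta>'. cinner (T (tens e h)) \<zeta>' = cinner (R (tens e h)) \<zeta>'}"
        by (intro closed_Collect_eq linear_continuous_on bounded_linear_cinner_right)
      show "csubspace {\<zeta>'. cinner (T (tens e h)) \<zeta>' = cinner (R (tens e h)) \<zeta>'}"
        by (simp add: complex_vector.subspace_def cinner_add_right cinner_scaleC_right)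
    qed (use eq that in auto)
    then show ?thesis
      by blast
  qed
  have "{\<zeta>. T \<zeta> = R \<zeta>} = UNIV"
  proof (rule closed_subspace_tens_eq_UNIV[OF assms(1)])
    show "closed {\<zeta>. T \<zeta> = R \<zeta>}"
      by (intro closed_Collect_eq linear_continuous_on blinfun.bounded_linear_right)
    show "csubspace {\<zeta>. T \<zeta> = R \<zeta>}"
      using assms(2,3) by (simp add: complex_vector.subspace_def blinfun.add_right bop_def)
    show "tens e h \<in> {\<zeta>. T \<zeta> = R \<zeta>}" if "e \<in> E" for e h
    proof (rule CollectI, rule cinner_ext)
      show "cinner (T (tens e h)) y = cinner (R (tens e h)) y" for y
        by (rule inner[OF that])
    qed
  qed
  then show ?thesis
    by (intro blinfun_eqI) blast
qed

section \<open>Blocks of the two tensor products and comparison of the constants\<close>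

lemma csubspace_min_tensor: "csubspace (min_tensor tens S)"
  unfolding min_tensor_def by (rule csubspace_closure) simp

lemma min_tensor_subset_bop: "min_tensor tens S \<subseteq> bop"
  unfolding min_tensor_def
  by (intro closure_minimal closed_bop complex_vector.span_minimal csubspace_bop)
    (auto simp: is_op_tensor_def)

text \<open>On an elementary operator \<open>a \<otimes> x\<close> the block is the multiple
  \<open>cinner (a k') k\<close> of \<open>x\<close>. The operators whose block lies in
  \<open>S\<close> form a norm closed subspace, so spans and norm limits cause no loss.\<close>

lemma compress_min_tensor:
  assumes "csubspace S" "closed S" "y \<in> min_tensor tens S"
  shows "adj (slice k) o\<^sub>L y o\<^sub>L slice k' \<in> S"
proof -
  let ?V = "{y. adj (slice k) o\<^sub>L y o\<^sub>L slice k' \<in> S}"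
  have "bounded_linear (\<lambda>y. adj (slice k) o\<^sub>L y o\<^sub>L slice k')"
    by (intro bounded_linear_compose[OF
          bounded_bilinear.bounded_linear_left[OF bounded_bilinear_blinfun_compose]
          bounded_bilinear.bounded_linear_right[OF bounded_bilinear_blinfun_compose]])
  then have "closed ?V"
    using continuous_closed_vimage[OF assms(2)] linear_continuous_at by (force simp: vimage_def)
  moreover have "csubspace ?V"
    using assms(1)
    by (simp add: complex_vector.subspace_def compress_add compress_scaleC clin_adj clin_slice)
  moreover have "T \<in> ?V" if "x \<in> S" "is_op_tensor tens a x T" for a x T
  proof -
    have "adj (slice k) o\<^sub>L T o\<^sub>L slice k' = cinner (a k') k *\<^sub>C x"
      using that(2) by (intro blinfun_eqI) (simp add: slice_apply is_op_tensor_def adj_slice)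
    then show ?thesis
      using that(1) complex_vector.subspace_scale[OF assms(1)] by simp
  qed
  ultimately have "min_tensor tens S \<subseteq> ?V"
    unfolding min_tensor_def by (intro closure_minimal complex_vector.span_minimal) auto
  then show ?thesis
    using assms(3) by blast
qed

lemma compress_weak_star_tensor:
  assumes "csubspace S" "closed S" "closedin weak_star S" "y \<in> weak_star_tensor tens S"
  shows "adj (slice k) o\<^sub>L y o\<^sub>L slice k' \<in> S"
proof -
  let ?f = "\<lambda>y. adj (slice k) o\<^sub>L y o\<^sub>L slice k'"
  have "?f ` (weak_star closure_of min_tensor tens S) \<subseteq> weak_star closure_of ?f ` min_tensor tens S"
    by (intro continuous_map_image_closure_subset continuous_map_weak_star_compress clin_slice)
  also have "\<dots> \<subseteq> S"
    using compress_min_tensor[OF assms(1,2)] by (intro closure_of_minimal assms(3)) auto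
  finally show ?thesis
    using assms(4) unfolding weak_star_tensor_def by blast
qed

text \<open>The operator is itself elementary: it is \<open>a \<otimes> x\<close> for the rank one
  operator \<open>a\<close> sending \<open>v\<close> to \<open>cinner v k'\<close> times
  \<open>k\<close>.\<close>

lemma embed_min_tensor:
  assumes "x \<in> S" "S \<subseteq> bop"
  shows "slice k o\<^sub>L x o\<^sub>L adj (slice k') \<in> min_tensor tens S"
proof -
  obtain a :: "'k \<Rightarrow>\<^sub>L 'k" where a: "\<And>v. a v = cinner v k' *\<^sub>C k"
  proof -
    have "bounded_linear (\<lambda>v. cinner v k' *\<^sub>C k)"
    proof
      show "cinner (r *\<^sub>R v) k' *\<^sub>C k = r *\<^sub>R (cinner v k' *\<^sub>C k)" for r v
        using cinner_scaleC_left[of "of_real r" v k']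
        by (simp add: scaleC_of_real scaleC_of_real[symmetric, of r "cinner v k' *\<^sub>C k"] scaleC_scaleC)
      show "\<exists>K. \<forall>v. norm (cinner v k' *\<^sub>C k) \<le> norm v * K"
      proof (intro exI allI)
        show "norm (cinner v k' *\<^sub>C k) \<le> norm v * (norm k' * norm k)" for v
          using mult_right_mono[OF cmod_cinner_le, of "norm k" v k'] by (simp add: norm_scaleC mult.assoc)
      qed
    qed (simp add: cinner_add_left scaleC_add_left)
    then show thesis
      using that[of "Blinfun (\<lambda>v. cinner v k' *\<^sub>C k)"] by (simp add: bounded_linear_Blinfun_apply)
  qed
  have x: "clin x"
    using assms by (auto simp: bop_eq_clin)
  have "a \<in> bop"
    by (simp add: bop_def a cinner_scaleC_left scaleC_scaleC)
  moreover have "is_op_tensor tens a x (slice k o\<^sub>L x o\<^sub>L adj (slice k'))"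
    unfolding is_op_tensor_def
  proof (intro conjI allI)
    show "slice k o\<^sub>L x o\<^sub>L adj (slice k') \<in> bop"
      using x by (auto simp: bop_eq_clin intro!: clin_compose clin_adj clin_slice)
    show "(slice k o\<^sub>L x o\<^sub>L adj (slice k')) (tens v h) = tens (a v) (x h)" for v h
      using x by (simp add: adj_slice a slice_apply clin_def tens_scaleC_left tens_scaleC_right)
  qed
  ultimately have "slice k o\<^sub>L x o\<^sub>L adj (slice k') \<in> {T. \<exists>a\<in>bop. \<exists>x\<in>S. is_op_tensor tens a x T}"
    using assms(1) by blast
  then show ?thesis
    unfolding min_tensor_def by (intro subsetD[OF closure_subset] complex_vector.span_base)
qed

lemma weak_star_tensor_facts:
  shows min_tensor_subset_weak_star_tensor: "min_tensor tens S \<subseteq> weak_star_tensor tens S"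
    and weak_star_tensor_subset_bop: "weak_star_tensor tens S \<subseteq> bop"
    and closedin_weak_star_tensor: "closedin weak_star (weak_star_tensor tens S)"
  using closure_of_subset[of "min_tensor tens S" weak_star] min_tensor_subset_bop
    closure_of_subset_topspace[of weak_star "min_tensor tens S"]
  by (simp_all add: weak_star_tensor_def)

text \<open>An infinite orthonormal basis contains n orthonormal vectors for every n, and their
  slices form a frame to which the averaging applies. Keeping \<open>M\<close> general treats both
  tensor products at once.\<close>

lemma lambda_cb_le_lambda_tensor:
  assumes "S \<subseteq> bop" "csubspace S" "closedin weak_star S"
    and inf: "\<not> (\<exists>B :: 'k set. finite B \<and> cspan B = UNIV)"
    and "M \<subseteq> bop" "min_tensor tens S \<subseteq> M"
    and compress: "\<And>y k k'. y \<in> M \<Longrightarrow> adj (slice k) o\<^sub>L y o\<^sub>L slice k' \<in> S"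
  shows "lambda_cb S \<le> lambda M"
  unfolding lambda_cb_eq_SUP_lambda_n[OF assms(3)]
proof (rule SUP_least)
  fix n :: nat
  assume "n \<in> {1..}"
  obtain E :: "'k set" where E: "orthonormal E" "total_set E"
    using orthonormal_basis_exists by blast
  then have "infinite E"
    using inf finite_orthonormal_basis_spans by blast
  then obtain A where A: "finite A" "card A = n" "A \<subseteq> E"
    using infinite_arbitrarily_large by blast
  then obtain g where g: "bij_betw g {..<n} A"
    using ex_bij_betw_nat_finite[OF A(1)] by (auto simp: atLeast0LessThan)
  have fr: "frame n (\<lambda>i. slice (g i))"
    using g A by (intro frame_reindex[OF frame_on_slice[OF E(1)]]) (auto simp: bij_betw_def)
  show "lambda_n n S \<le> lambda M"
    using \<open>n \<in> {1..}\<close> compress embed_min_tensor[OF _ assms(1)] assms(6)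
    by (intro lambda_n_le_lambda_frame[OF _ assms(2,1) fr assms(5)]) auto
qed

text \<open>A finite amplification sees only a corner of an operator, so it need not fix the
  elements of the target space. Along growing subsets of the basis the corners exhaust all
  coefficients, and the limit does fix them. The completely bounded norm bounds all amplifications
  uniformly, as the limit requires.\<close>

lemma lambda_weak_star_tensor_le_lambda_cb:
  assumes "S \<subseteq> bop" "csubspace S" "closed S" "closedin weak_star S"
  shows "lambda (weak_star_tensor tens S) \<le> lambda_cb S"
  unfolding lambda_def lambda_cb_def
proof (rule Inf_superset_mono, clarify)
  fix c P
  assume P: "projection_onto S P" "cb_norm P \<le> ereal c"
  let ?M = "weak_star_tensor tens S"
  have amp: "amp_norm n P \<le> ereal c" if "1 \<le> n" for n
    using P(2) that unfolding cb_norm_def SUP_le_iff by simp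
  have c0: "0 \<le> c"
    using amp_norm_leD(1)[OF P(1) amp[OF order_refl]] .
  obtain E :: "'k set" where E: "orthonormal E" "total_set E"
    using orthonormal_basis_exists by blast
  define \<Phi> where "\<Phi> F y = (if finite F \<and> F \<subseteq> E \<and> y \<in> bop then amplify F slice P y else 0)" for F y
  have \<Phi>_min: "\<Phi> F y \<in> min_tensor tens S" for F y
    using amplify_in[where J = slice and I = F, OF clin_slice P(1) _ csubspace_min_tensor embed_min_tensor[OF _ assms(1)]]
      complex_vector.subspace_0[OF csubspace_min_tensor] by (simp add: \<Phi>_def)
  then have \<Phi>_bop: "\<Phi> F y \<in> bop" for F y
    using min_tensor_subset_bop by blast
  \<comment> \<open>The empty subset is treated apart: \<open>cb_norm\<close> is a supremum over
    levels from 1 on and so says nothing directly at level 0, but the empty amplification is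
    0.\<close>
  have \<Phi>_norm: "norm (\<Phi> F y) \<le> c * norm y" for F y
  proof (cases "finite F \<and> F \<subseteq> E \<and> y \<in> bop \<and> F \<noteq> {}")
    case True
    then have "1 \<le> card F"
      by (simp add: Suc_le_eq card_gt_0_iff)
    with True show ?thesis
      using norm_amplify_le[OF frame_on_subset[OF frame_on_slice[OF E(1)]] _ P(1) amp] by (simp add: \<Phi>_def)
  next
    case False
    then have "\<Phi> F y = 0"
      by (auto simp: \<Phi>_def amplify_def)
    then show ?thesis
      using c0 by simp
  qed
  obtain G \<Psi> where G: "G \<le> finite_subsets_at_top E" "G \<noteq> bot" and \<Psi>: "\<And>y. \<Psi> y \<in> bop"
    and \<Psi>_norm: "\<And>y. norm (\<Psi> y) \<le> c * norm y" and lim: "\<And>y. wot_limit (\<lambda>F. \<Phi> F y) (\<Psi> y) G"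
    by (rule wot_limit_along_finer_filter[of "finite_subsets_at_top E" \<Phi> "\<lambda>y. c * norm y"])
      (use \<Phi>_bop \<Phi>_norm in auto)
  have "projection_onto ?M \<Psi>"
    unfolding projection_onto_def
  proof (intro conjI ballI allI subsetI)
    show "\<Psi> (T + R) = \<Psi> T + \<Psi> R" if "T \<in> bop" "R \<in> bop" for T R
    proof (rule wot_limit_unique[OF lim _ G(2)])
      have "\<Phi> F (T + R) = \<Phi> F T + \<Phi> F R" for F
        using that by (simp add: \<Phi>_def bop_add amplify_add[OF clin_slice P(1)])
      then show "wot_limit (\<lambda>F. \<Phi> F (T + R)) (\<Psi> T + \<Psi> R) G"
        using wot_limit_add[OF lim lim] by simp
    qed
    show "\<Psi> (a *\<^sub>C T) = a *\<^sub>C \<Psi> T" if "T \<in> bop" for a T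
    proof (rule wot_limit_unique[OF lim _ G(2)])
      have "\<Phi> F (a *\<^sub>C T) = a *\<^sub>C \<Phi> F T" for F
        using that
        by (simp add: \<Phi>_def bop_scaleC amplify_scaleC[OF clin_slice P(1)] complex_vector.scale_zero_right)
      then show "wot_limit (\<lambda>F. \<Phi> F (a *\<^sub>C T)) (a *\<^sub>C \<Psi> T) G"
        using wot_limit_scaleC[OF lim] by simp
    qed
    show "R \<in> ?M" if "R \<in> \<Psi> ` bop" for R
    proof -
      from that obtain y where y: "R = \<Psi> y"
        by blast
      have "limitin weak_star (\<lambda>F. \<Phi> F y) (\<Psi> y) G"
        by (rule wot_limit_imp_limitin_weak_star[OF lim \<Phi>_norm \<Phi>_bop \<Psi>])
      then show ?thesis
        unfolding y
        by (rule limitin_closedin[OF _ closedin_weak_star_tensor])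
          (use \<Phi>_min min_tensor_subset_weak_star_tensor G(2) in \<open>auto intro!: always_eventually\<close>)
    qed
    show "\<Psi> T = T" if "T \<in> ?M" for T
    proof (rule bop_eq_of_tens[OF E(2) \<Psi>])
      show "T \<in> bop"
        using that weak_star_tensor_subset_bop by blast
      fix e e' h h'
      assume ee: "e \<in> E" "e' \<in> E"
      \<comment> \<open>Once \<open>F\<close> contains \<open>e\<close> and \<open>e'\<close>,
        orthonormality leaves only the term with \<open>j = e\<close> and \<open>i = e'\<close>,
        where \<open>P\<close> fixes the block of \<open>T\<close>.\<close>
      have "cinner (\<Phi> F T (tens e h)) (tens e' h') = cinner (T (tens e h)) (tens e' h')"
        if F: "finite F" "F \<subseteq> E" "e \<in> F" "e' \<in> F" for F
      proof -
        have P_fix: "P (adj (slice i) o\<^sub>L T o\<^sub>L slice j) = adj (slice i) o\<^sub>L T o\<^sub>L slice j" for i j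
          by (rule projection_fixes[OF P(1) compress_weak_star_tensor[OF assms(2,3,4) \<open>T \<in> ?M\<close>]])
        have adj_e: "adj (slice j) (tens e h) = (if j = e then h else 0)" if "j \<in> F" for j
          using E(1) that F ee by (auto simp: adj_slice orthonormal_def)
        have "\<Phi> F T (tens e h) = (\<Sum>i\<in>F. \<Sum>j\<in>F. slice i (adj (slice i) (T (slice j (adj (slice j) (tens e h))))))"
          using F \<open>T \<in> bop\<close> by (simp add: \<Phi>_def amplify_def P_fix blinfun.sum_left)
        also have "\<dots> = (\<Sum>i\<in>F. \<Sum>j\<in>F. if j = e then slice i (adj (slice i) (T (tens e h))) else 0)"
          by (intro sum.cong refl) (simp add: adj_e, simp add: slice_apply)
        also have "\<dots> = (\<Sum>i\<in>F. slice i (adj (slice i) (T (tens e h))))"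
          using F by simp
        finally have "cinner (\<Phi> F T (tens e h)) (tens e' h')
            = (\<Sum>i\<in>F. cinner (slice i (adj (slice i) (T (tens e h)))) (slice e' h'))"
          by (simp add: cinner_sum_left slice_apply)
        also have "\<dots> = (\<Sum>i\<in>F. if i = e' then cinner (adj (slice i) (T (tens e h))) h' else 0)"
        proof (rule sum.cong[OF refl])
          fix i
          assume "i \<in> F"
          then show "cinner (slice i (adj (slice i) (T (tens e h)))) (slice e' h')
              = (if i = e' then cinner (adj (slice i) (T (tens e h))) h' else 0)"
            using frame_on_slice[OF E(1)] F unfolding frame_on_def by (metis subsetD)
        qed
        also have "\<dots> = cinner (T (tens e h)) (tens e' h')"
          using F by (simp add: cinner_adj_left[OF clin_slice] slice_apply)
        finally show ?thesis .
      qed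
      then have "eventually (\<lambda>F. cinner (\<Phi> F T (tens e h)) (tens e' h') = cinner (T (tens e h)) (tens e' h'))
          (finite_subsets_at_top E)"
        unfolding eventually_finite_subsets_at_top using ee by (intro exI[of _ "{e, e'}"]) auto
      then have "((\<lambda>F. cinner (\<Phi> F T (tens e h)) (tens e' h')) \<longlongrightarrow> cinner (T (tens e h)) (tens e' h')) G"
        using G(1) by (intro tendsto_eventually) (rule filter_leD)
      then show "cinner (\<Psi> T (tens e h)) (tens e' h') = cinner (T (tens e h)) (tens e' h')"
        by (rule tendsto_unique[OF G(2) wot_limitD[OF lim]])
    qed
  qed
  moreover have "map_norm \<Psi> \<le> ereal c"
    by (rule map_norm_leI[OF c0 \<Psi>_norm])
  ultimately show "\<exists>c'. ereal c = ereal c' \<and> (\<exists>P. projection_onto ?M P \<and> map_norm P \<le> ereal c')"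
    by blast
qed

end

theorem proposition4p4:
  fixes S :: "('h::complex_hilbert \<Rightarrow>\<^sub>L 'h) set"
  assumes "S \<subseteq> bop" and "csubspace S" and "closed S"
  shows "lambda_n CARD('n::finite) S = lambda (matrix_space S :: (('h ^ 'n) \<Rightarrow>\<^sub>L ('h ^ 'n)) set) \<and>
    (closedin weak_star S \<longrightarrow>
       lambda_cb S = (SUP n\<in>{1..}. lambda_n n S) \<and>
       (\<forall>tens :: 'k::complex_hilbert \<Rightarrow> 'h \<Rightarrow> 't::complex_hilbert.
          hilbert_tensor tens \<and> \<not> (\<exists>B :: 'k set. finite B \<and> cspan B = UNIV) \<longrightarrow>
            lambda_cb S \<le> lambda (min_tensor tens S) \<and>
            lambda_cb S = lambda (weak_star_tensor tens S)))"
proof (intro conjI impI allI)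
  show "lambda_n CARD('n) S = lambda (matrix_space S :: (('h ^ 'n) \<Rightarrow>\<^sub>L ('h ^ 'n)) set)"
    by (rule lambda_n_eq_lambda_matrix_space[OF assms(1,2)])
next
  assume closed: "closedin weak_star S"
  then show "lambda_cb S = (SUP n\<in>{1..}. lambda_n n S)"
    by (rule lambda_cb_eq_SUP_lambda_n)
  fix tens :: "'k \<Rightarrow> 'h \<Rightarrow> 't"
  assume "hilbert_tensor tens \<and> \<not> (\<exists>B :: 'k set. finite B \<and> cspan B = UNIV)"
  then have tens: "hilbert_tensor tens" and inf: "\<not> (\<exists>B :: 'k set. finite B \<and> cspan B = UNIV)"
    by auto
  show "lambda_cb S \<le> lambda (min_tensor tens S)"
    by (rule lambda_cb_le_lambda_tensor[OF tens assms(1,2) closed inf min_tensor_subset_bop order_refl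
          compress_min_tensor[OF tens assms(2,3)]]) (rule tens)
  show "lambda_cb S = lambda (weak_star_tensor tens S)"
  proof (rule antisym)
    show "lambda_cb S \<le> lambda (weak_star_tensor tens S)"
      by (rule lambda_cb_le_lambda_tensor[OF tens assms(1,2) closed inf
            weak_star_tensor_subset_bop[OF tens] min_tensor_subset_weak_star_tensor[OF tens]
            compress_weak_star_tensor[OF tens assms(2,3) closed]])
    show "lambda (weak_star_tensor tens S) \<le> lambda_cb S"
      by (rule lambda_weak_star_tensor_le_lambda_cb[OF tens assms closed])
  qed
qed

end
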